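(* Let $H$ be a graded, connected Hopf algebra over $K$ which is both free and cofree, let $\mathfrak{g}=\mathrm{Prim}(H)$, and choose a non-degenerate, homogeneous bilinear form on the graded space $\frac{\mathfrak{g}}{\mathfrak{g}\cap H^{+2}}$. Then there exists a non-degenerate Hopf pairing $\langle -,-\rangle : H\times H\to K$ whose induced pairing on $\frac{\mathfrak{g}}{\mathfrak{g}\cap H^{+2}}$ is the chosen form. Moreover, if the chosen form on $\frac{\mathfrak{g}}{\mathfrak{g}\cap H^{+2}}$ is symmetric, the Hopf pairing on $H$ can be chosen symmetric.
   Context: $K$ is a commutative field of characteristic $\neq 2$. A graded connected Hopf algebra is a Hopf algebra $H=\bigoplus_{n\ge0}H_n$ over $K$ whose product, unit, coproduct $\Delta$ and counit $\varepsilon$ are homogeneous, with $H_0=K$ and every $H_n$ finite-dimensional. $H^+=\bigoplus_{n\ge1}H_n$ is the augmentation ideal and $H^{+2}$ is the span of all products $xy$ with $x,y\in H^+$. $\mathrm{Prim}(H)=\{x:\Delta(x)=x\otimes1+1\otimes x\}$ is the graded Lie algebra of primitive elements. $H$ is free if there is a graded subspace $V\subseteq H$ such that the canonical algebra map $T(V)\to H$ is an isomorphism; $H$ is cofree if it is isomorphic, as a graded coalgebra, to the tensor coalgebra $coT(W)$ (the space $T(W)$ with the deconcatenation coproduct) for some graded space $W$ with $W_0=0$. A bilinear form on a graded space is homogeneous if homogeneous elements of different degrees pair to $0$. A (homogeneous) Hopf pairing between graded connected Hopf algebras $H,H'$ is a bilinear form $\langle-,-\rangle:H\times H'\to K$ with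 $\langle x,1\rangle=\varepsilon(x)$, $\langle 1,x'\rangle=\varepsilon(x')$, $\langle xy,z'\rangle=\langle x\otimes y,\Delta(z')\rangle$, $\langle x,y'z'\rangle=\langle\Delta(x),y'\otimes z'\rangle$ (where $\langle a\otimes b,c\otimes d\rangle=\langle a,c\rangle\langle b,d\rangle$), and $\langle H_i,H'_j\rangle=0$ for $i\ne j$. For a Hopf pairing on $H\times H$, primitive elements are orthogonal to $H^{+2}$, so $\langle \bar x,\bar y\rangle:=\langle x,y\rangle$ ($x,y\in\mathfrak g$) gives a well-defined pairing on $\frac{\mathfrak{g}}{\mathfrak{g}\cap H^{+2}}$, called the induced pairing. *)

theory Defs
  imports Complex_Main
begin

text \<open>
Encoding conventions.
  The ground field K is a type 'k of class field; characteristic different from 2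
  is the assumption (2::'k) \<noteq> 0.
  The Hopf algebra H is the whole of a type 'h (an abelian group) with scalar
  multiplication sc :: 'k \<Rightarrow> 'h \<Rightarrow> 'h; gr n is the homogeneous
  component H_n; mult and one are product and unit; cou is the counit, ant the antipode.
  Elements of H \<otimes> H are represented by finite lists of pairs
  [(a1,b1),...,(ak,bk)] standing for the sum of the ai \<otimes> bi; two such lists
  represent the same tensor iff every bilinear form H \<times> H \<rightarrow> K takes the same
  value on them (bilinear forms separate points of the algebraic tensor product).
  Likewise trilinear forms separate H \<otimes> H \<otimes> H.
  The coproduct is cop :: 'h \<Rightarrow> ('h \<times> 'h) list.
\<close>

definition bilinear_form :: "('k::field \<Rightarrow> 'h::ab_group_add \<Rightarrow> 'h) \<Rightarrow> ('h \<Rightarrow> 'h \<Rightarrow> 'k) \<Rightarrow> bool" where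
  "bilinear_form sc f \<longleftrightarrow>
     (\<forall>x y z. f (x + y) z = f x z + f y z \<and> f z (x + y) = f z x + f z y) \<and>
     (\<forall>c x y. f (sc c x) y = c * f x y \<and> f x (sc c y) = c * f x y)"

definition trilinear_form :: "('k::field \<Rightarrow> 'h::ab_group_add \<Rightarrow> 'h) \<Rightarrow> ('h \<Rightarrow> 'h \<Rightarrow> 'h \<Rightarrow> 'k) \<Rightarrow> bool" where
  "trilinear_form sc g \<longleftrightarrow>
     (\<forall>x y z w. g (x + y) z w = g x z w + g y z w \<and> g z (x + y) w = g z x w + g z y w
               \<and> g z w (x + y) = g z w x + g z w y) \<and>
     (\<forall>c x y z. g (sc c x) y z = c * g x y z \<and> g x (sc c y) z = c * g x y z
               \<and> g x y (sc c z) = c * g x y z)"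

definition tensor_eq :: "('k::field \<Rightarrow> 'h::ab_group_add \<Rightarrow> 'h) \<Rightarrow> ('h \<times> 'h) list \<Rightarrow> ('h \<times> 'h) list \<Rightarrow> bool" where
  "tensor_eq sc t u \<longleftrightarrow>
     (\<forall>f. bilinear_form sc f \<longrightarrow> (\<Sum>(a, b)\<leftarrow>t. f a b) = (\<Sum>(a, b)\<leftarrow>u. f a b))"

definition word :: "('h \<Rightarrow> 'h \<Rightarrow> 'h) \<Rightarrow> 'h \<Rightarrow> 'h list \<Rightarrow> 'h" where
  "word mult one w = foldr mult w one"

locale graded_connected_hopf_algebra =
  fixes sc :: "'k::field \<Rightarrow> 'h::ab_group_add \<Rightarrow> 'h"
    and gr :: "nat \<Rightarrow> 'h set"
    and mult :: "'h \<Rightarrow> 'h \<Rightarrow> 'h"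
    and one :: 'h
    and cop :: "'h \<Rightarrow> ('h \<times> 'h) list"
    and cou :: "'h \<Rightarrow> 'k"
    and ant :: "'h \<Rightarrow> 'h"
  assumes vs: "vector_space sc"
    and gr_subspace: "\<And>n. module.subspace sc (gr n)"
    and gr_findim: "\<And>n. \<exists>F. finite F \<and> F \<subseteq> gr n \<and> module.span sc F = gr n"
    and gr_span: "module.span sc (\<Union>n. gr n) = UNIV"
    and gr_indep: "\<And>N x. finite N \<Longrightarrow> (\<forall>n\<in>N. x n \<in> gr n) \<Longrightarrow> (\<Sum>n\<in>N. x n) = 0
                     \<Longrightarrow> \<forall>n\<in>N. x n = 0"
    and one_nz: "one \<noteq> 0"
    and gr0: "gr 0 = range (\<lambda>c. sc c one)"
    and mult_add_left: "\<And>x y z. mult (x + y) z = mult x z + mult y z"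
    and mult_add_right: "\<And>x y z. mult z (x + y) = mult z x + mult z y"
    and mult_sc_left: "\<And>c x y. mult (sc c x) y = sc c (mult x y)"
    and mult_sc_right: "\<And>c x y. mult x (sc c y) = sc c (mult x y)"
    and mult_assoc: "\<And>x y z. mult (mult x y) z = mult x (mult y z)"
    and mult_one_left: "\<And>x. mult one x = x"
    and mult_one_right: "\<And>x. mult x one = x"
    and mult_homog: "\<And>i j x y. x \<in> gr i \<Longrightarrow> y \<in> gr j \<Longrightarrow> mult x y \<in> gr (i + j)"
    and cop_add: "\<And>x y. tensor_eq sc (cop (x + y)) (cop x @ cop y)"
    and cop_sc: "\<And>c x. tensor_eq sc (cop (sc c x)) (map (\<lambda>(a, b). (sc c a, b)) (cop x))"
    and coassoc: "\<And>g x. trilinear_form sc g \<Longrightarrow>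
        (\<Sum>(a, b)\<leftarrow>cop x. \<Sum>(c, d)\<leftarrow>cop a. g c d b) = (\<Sum>(a, b)\<leftarrow>cop x. \<Sum>(c, d)\<leftarrow>cop b. g a c d)"
    and cou_add: "\<And>x y. cou (x + y) = cou x + cou y"
    and cou_sc: "\<And>c x. cou (sc c x) = c * cou x"
    and counit_left: "\<And>x. (\<Sum>(a, b)\<leftarrow>cop x. sc (cou a) b) = x"
    and counit_right: "\<And>x. (\<Sum>(a, b)\<leftarrow>cop x. sc (cou b) a) = x"
    and cop_homog: "\<And>n x. x \<in> gr n \<Longrightarrow>
        \<exists>t. tensor_eq sc (cop x) t \<and> (\<forall>(a, b)\<in>set t. \<exists>i j. i + j = n \<and> a \<in> gr i \<and> b \<in> gr j)"
    and cou_homog: "\<And>n x. n \<ge> 1 \<Longrightarrow> x \<in> gr n \<Longrightarrow> cou x = 0"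
    and cop_mult: "\<And>x y. tensor_eq sc (cop (mult x y))
        (concat (map (\<lambda>(a, b). map (\<lambda>(c, d). (mult a c, mult b d)) (cop y)) (cop x)))"
    and cop_one: "tensor_eq sc (cop one) [(one, one)]"
    and cou_mult: "\<And>x y. cou (mult x y) = cou x * cou y"
    and cou_one: "cou one = 1"
    and ant_add: "\<And>x y. ant (x + y) = ant x + ant y"
    and ant_sc: "\<And>c x. ant (sc c x) = sc c (ant x)"
    and antipode_left: "\<And>x. (\<Sum>(a, b)\<leftarrow>cop x. mult (ant a) b) = sc (cou x) one"
    and antipode_right: "\<And>x. (\<Sum>(a, b)\<leftarrow>cop x. mult a (ant b)) = sc (cou x) one"

definition prim :: "('k::field \<Rightarrow> 'h::ab_group_add \<Rightarrow> 'h) \<Rightarrow> 'h \<Rightarrow> ('h \<Rightarrow> ('h \<times> 'h) list) \<Rightarrow> 'h set" where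
  "prim sc one cop = {x. tensor_eq sc (cop x) [(x, one), (one, x)]}"

definition aug_ideal :: "('k::field \<Rightarrow> 'h::ab_group_add \<Rightarrow> 'h) \<Rightarrow> (nat \<Rightarrow> 'h set) \<Rightarrow> 'h set" where
  "aug_ideal sc gr = module.span sc (\<Union>n\<in>{1..}. gr n)"

definition aug_ideal_sq :: "('k::field \<Rightarrow> 'h::ab_group_add \<Rightarrow> 'h) \<Rightarrow> (nat \<Rightarrow> 'h set) \<Rightarrow> ('h \<Rightarrow> 'h \<Rightarrow> 'h) \<Rightarrow> 'h set" where
  "aug_ideal_sq sc gr mult =
     module.span sc {mult x y | x y. x \<in> aug_ideal sc gr \<and> y \<in> aug_ideal sc gr}"

text \<open>H is free: H \<cong> T(V) via the canonical algebra map, V = span B a graded subspace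
  with homogeneous basis B; i.e. the products of words in B are pairwise distinct and
  form a basis of H.\<close>
definition free_graded_algebra ::
  "('k::field \<Rightarrow> 'h::ab_group_add \<Rightarrow> 'h) \<Rightarrow> (nat \<Rightarrow> 'h set) \<Rightarrow> ('h \<Rightarrow> 'h \<Rightarrow> 'h) \<Rightarrow> 'h \<Rightarrow> bool" where
  "free_graded_algebra sc gr mult one \<longleftrightarrow>
     (\<exists>B. B \<subseteq> (\<Union>n. gr n) \<and> inj_on (word mult one) (lists B)
        \<and> \<not> module.dependent sc (word mult one ` lists B)
        \<and> module.span sc (word mult one ` lists B) = UNIV)"

text \<open>H is cofree: a graded coalgebra isomorphism coT(W) \<rightarrow> H, W graded with W_0 = 0.
  W has a homogeneous basis indexed by B (letters b of degree deg b \<ge> 1); e w is the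
  image of the word w, which has degree the sum of the degrees of its letters; the
  coalgebra structure of coT(W) is deconcatenation with counit the projection on
  the empty word.\<close>
definition cofree_graded_coalgebra ::
  "('k::field \<Rightarrow> 'h::ab_group_add \<Rightarrow> 'h) \<Rightarrow> (nat \<Rightarrow> 'h set) \<Rightarrow> ('h \<Rightarrow> ('h \<times> 'h) list) \<Rightarrow> ('h \<Rightarrow> 'k) \<Rightarrow> bool" where
  "cofree_graded_coalgebra sc gr cop cou \<longleftrightarrow>
     (\<exists>(B :: 'h set) (deg :: 'h \<Rightarrow> nat) (e :: 'h list \<Rightarrow> 'h).
        (\<forall>b\<in>B. deg b \<ge> 1)
      \<and> inj_on e (lists B)
      \<and> \<not> module.dependent sc (e ` lists B)
      \<and> module.span sc (e ` lists B) = UNIV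
      \<and> (\<forall>w\<in>lists B. e w \<in> gr (\<Sum>b\<leftarrow>w. deg b))
      \<and> (\<forall>w\<in>lists B. tensor_eq sc (cop (e w))
            (map (\<lambda>i. (e (take i w), e (drop i w))) [0..<Suc (length w)]))
      \<and> (\<forall>w\<in>lists B. cou (e w) = (if w = [] then 1 else 0)))"

definition hopf_pairing ::
  "('k::field \<Rightarrow> 'h::ab_group_add \<Rightarrow> 'h) \<Rightarrow> (nat \<Rightarrow> 'h set) \<Rightarrow> ('h \<Rightarrow> 'h \<Rightarrow> 'h) \<Rightarrow> 'h
    \<Rightarrow> ('h \<Rightarrow> ('h \<times> 'h) list) \<Rightarrow> ('h \<Rightarrow> 'k) \<Rightarrow> ('h \<Rightarrow> 'h \<Rightarrow> 'k) \<Rightarrow> bool" where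
  "hopf_pairing sc gr mult one cop cou P \<longleftrightarrow>
     bilinear_form sc P
   \<and> (\<forall>x. P x one = cou x) \<and> (\<forall>x. P one x = cou x)
   \<and> (\<forall>x y z. P (mult x y) z = (\<Sum>(a, b)\<leftarrow>cop z. P x a * P y b))
   \<and> (\<forall>x y z. P x (mult y z) = (\<Sum>(a, b)\<leftarrow>cop x. P a y * P b z))
   \<and> (\<forall>i j x y. i \<noteq> j \<longrightarrow> x \<in> gr i \<longrightarrow> y \<in> gr j \<longrightarrow> P x y = 0)"

definition nondegenerate :: "('h::zero \<Rightarrow> 'h \<Rightarrow> 'k::zero) \<Rightarrow> bool" where
  "nondegenerate P \<longleftrightarrow> (\<forall>x. (\<forall>y. P x y = 0) \<longrightarrow> x = 0) \<and> (\<forall>y. (\<forall>x. P x y = 0) \<longrightarrow> y = 0)"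

text \<open>A bilinear form on the quotient g/(g \<inter> H^{+2}) (g = Prim H) is represented by a
  function beta on g \<times> g which is bilinear on g and vanishes whenever one argument
  lies in g \<inter> H^{+2}.\<close>
definition quotient_form ::
  "('k::field \<Rightarrow> 'h::ab_group_add \<Rightarrow> 'h) \<Rightarrow> 'h set \<Rightarrow> 'h set \<Rightarrow> ('h \<Rightarrow> 'h \<Rightarrow> 'k) \<Rightarrow> bool" where
  "quotient_form sc g I \<beta> \<longleftrightarrow>
     (\<forall>x\<in>g. \<forall>y\<in>g. \<forall>z\<in>g. \<beta> (x + y) z = \<beta> x z + \<beta> y z \<and> \<beta> z (x + y) = \<beta> z x + \<beta> z y)
   \<and> (\<forall>c. \<forall>x\<in>g. \<forall>y\<in>g. \<beta> (sc c x) y = c * \<beta> x y \<and> \<beta> x (sc c y) = c * \<beta> x y)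
   \<and> (\<forall>x\<in>g \<inter> I. \<forall>y\<in>g. \<beta> x y = 0 \<and> \<beta> y x = 0)"

definition quotient_form_nondegenerate :: "'h set \<Rightarrow> 'h set \<Rightarrow> ('h \<Rightarrow> 'h \<Rightarrow> 'k::zero) \<Rightarrow> bool" where
  "quotient_form_nondegenerate g I \<beta> \<longleftrightarrow>
     (\<forall>x\<in>g. (\<forall>y\<in>g. \<beta> x y = 0) \<longrightarrow> x \<in> I) \<and> (\<forall>y\<in>g. (\<forall>x\<in>g. \<beta> x y = 0) \<longrightarrow> y \<in> I)"

text \<open>Homogeneity: the quotient is graded by the images of g \<inter> H_n.\<close>
definition quotient_form_homogeneous :: "(nat \<Rightarrow> 'h set) \<Rightarrow> 'h set \<Rightarrow> ('h \<Rightarrow> 'h \<Rightarrow> 'k::zero) \<Rightarrow> bool" where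
  "quotient_form_homogeneous gr g \<beta> \<longleftrightarrow>
     (\<forall>i j. \<forall>x\<in>g \<inter> gr i. \<forall>y\<in>g \<inter> gr j. i \<noteq> j \<longrightarrow> \<beta> x y = 0)"

end

theory Submission
  imports Defs
begin

text \<open>
  The pairing is built degree by degree. Suppose it is known and non-degenerate in degrees below
  \<open>n\<close>. Since \<open>H\<close> is free, the two Hopf identities define it consistently on \<open>H\<^sub>n \<times> S\<close> and
  \<open>S \<times> H\<^sub>n\<close>, where \<open>S\<close> is the degree \<open>n\<close> part of the square of the augmentation ideal. The
  orthogonal of \<open>S\<close> is the space \<open>\<gg>\<^sub>n\<close> of primitive elements, so the chosen form may be
  prescribed on \<open>\<gg>\<^sub>n \<times> \<gg>\<^sub>n\<close>, and what is then still free is set to zero. If \<open>x\<close> is orthogonal to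
  \<open>H\<^sub>n\<close>, it is orthogonal to \<open>S\<close>, hence primitive, hence in \<open>S\<close> because the chosen form is
  non-degenerate. Finally no nonzero element of \<open>S\<close> is orthogonal to \<open>H\<^sub>n\<close>: freeness and
  cofreeness together give \<open>dim S + dim \<gg>\<^sub>n = dim H\<^sub>n\<close>, since the number of generators of each
  degree is determined by the Hilbert series in both cases. Every choice is symmetric if the
  chosen form is.
\<close>

section \<open>Linear systems over a field and counting words\<close>

text \<open>The three prescriptions in degree \<open>n\<close> can coexist because they agree on
  overlaps. On S x S the two Hopf identities give the same value since the coproduct is
  multiplicative. On a primitive element and an element of S the Hopf identities give 0, and so does
  the chosen form when that element of S is itself primitive. As S and \<open>\<gg>\<^sub>n\<close>
  may intersect and need not span \<open>H\<^sub>n\<close>, the form is glued along a decomposition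
  adapted to both. The obstacle is a kernel inside S: the values on
  \<open>H\<^sub>n \<times> S\<close> are forced, so no choice could repair it. The count of
  generators enters as a square matrix, whose rows and columns are the words of length at least two
  in the free generators and in the cogenerators; a trivial kernel on one side then gives one on the
  other. At every stage the form lives on all of H, and only the identities are restricted to low
  degrees. The next stage alters a single block, so each value stabilises.\<close>

lemma underdetermined_system:
  fixes M :: "'a \<Rightarrow> 'b \<Rightarrow> 'k::field"
  assumes "finite A" "finite C" "card A < card C"
  shows "\<exists>l. (\<exists>c\<in>C. l c \<noteq> 0) \<and> (\<forall>a\<in>A. (\<Sum>c\<in>C. M a c * l c) = 0)"
  using assms
proof (induction A arbitrary: C M rule: finite_induct)
  case empty
  then obtain c where "c \<in> C" by fastforce
  then show ?case by (intro exI[of _ "\<lambda>_. 1"]) auto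
next
  case (insert a A)
  show ?case
  proof (cases "\<forall>c\<in>C. M a c = 0")
    case True
    obtain l where "\<exists>c\<in>C. l c \<noteq> 0" "\<forall>b\<in>A. (\<Sum>c\<in>C. M b c * l c) = 0"
      using insert.IH[of C M] insert.prems insert.hyps by auto
    with True show ?thesis by (intro exI[of _ l]) auto
  next
    case False
    then obtain c0 where c0: "c0 \<in> C" "M a c0 \<noteq> 0" by blast
    define C' where "C' = C - {c0}"
    have C': "finite C'" "c0 \<notin> C'" "C = insert c0 C'"
      using c0 insert.prems by (auto simp: C'_def)
    have "card A < card C'"
      using insert.prems insert.hyps C' by simp
    \<comment> \<open>Gaussian elimination: equation \<open>a\<close>, with pivot \<open>c0\<close>,
      is subtracted from the others, which leaves one equation and one unknown fewer.\<close>
    then obtain l where l: "\<exists>c\<in>C'. l c \<noteq> 0"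
      "\<And>b. b \<in> A \<Longrightarrow> (\<Sum>c\<in>C'. (M b c - M b c0 * M a c / M a c0) * l c) = 0"
      using insert.IH[of C' "\<lambda>b c. M b c - M b c0 * M a c / M a c0"] C' by blast
    \<comment> \<open>Back substitution: the value of the unknown \<open>c0\<close> that equation
      \<open>a\<close> forces.\<close>
    define t where "t = - (\<Sum>c\<in>C'. M a c * l c) / M a c0"
    define l' where "l' = l(c0 := t)"
    have sum: "(\<Sum>c\<in>C. M b c * l' c) = M b c0 * t + (\<Sum>c\<in>C'. M b c * l c)" for b
    proof -
      have "(\<Sum>c\<in>C'. M b c * l' c) = (\<Sum>c\<in>C'. M b c * l c)"
        by (rule sum.cong) (use C' in \<open>auto simp: l'_def\<close>)
      then show ?thesis
        by (subst C'(3), subst sum.insert) (use C' in \<open>auto simp: l'_def\<close>)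
    qed
    have "(\<Sum>c\<in>C. M b c * l' c) = 0" if "b \<in> insert a A" for b
    proof (cases "b = a")
      case True
      then show ?thesis using c0 by (simp add: sum t_def)
    next
      case False
      with that have "b \<in> A" by simp
      from l(2)[OF this]
      have "(\<Sum>c\<in>C'. M b c * l c) = (\<Sum>c\<in>C'. M b c0 / M a c0 * (M a c * l c))"
        by (simp add: algebra_simps sum_subtractf)
      also have "\<dots> = M b c0 / M a c0 * (\<Sum>c\<in>C'. M a c * l c)"
        by (rule sum_distrib_left[symmetric])
      finally show ?thesis using c0 by (simp add: sum t_def)
    qed
    moreover have "\<exists>c\<in>C. l' c \<noteq> 0"
      using l(1) C' unfolding l'_def by fastforce
    ultimately show ?thesis by blast
  qed
qed

text \<open>If row \<open>a\<close> had a nonzero coefficient in a relation between the rows,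
  dropping it would leave fewer equations than unknowns, hence a nonzero solution \<open>l\<close>;
  the relation makes row \<open>a\<close> kill \<open>l\<close> as well, against the trivial
  kernel.\<close>

lemma trivial_kernel_transpose:
  fixes M :: "'a \<Rightarrow> 'b \<Rightarrow> 'k::field"
  assumes fin: "finite A" "finite C" and card: "card A \<le> card C"
    and inj: "\<And>l. (\<And>a. a \<in> A \<Longrightarrow> (\<Sum>c\<in>C. M a c * l c) = 0) \<Longrightarrow> \<forall>c\<in>C. l c = 0"
    and m: "\<And>c. c \<in> C \<Longrightarrow> (\<Sum>a\<in>A. m a * M a c) = 0" and "a \<in> A"
  shows "m a = 0"
proof (rule ccontr)
  assume nz: "m a \<noteq> 0"
  have "card (A - {a}) < card C"
    using fin card \<open>a \<in> A\<close> by (metis card_Diff1_less order_less_le_trans)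
  then obtain l where l: "\<exists>c\<in>C. l c \<noteq> 0" "\<forall>b\<in>A - {a}. (\<Sum>c\<in>C. M b c * l c) = 0"
    using underdetermined_system[of "A - {a}" C M] fin by auto
  have "0 = (\<Sum>c\<in>C. (\<Sum>b\<in>A. m b * M b c) * l c)" using m by simp
  also have "\<dots> = (\<Sum>b\<in>A. m b * (\<Sum>c\<in>C. M b c * l c))"
    by (simp add: sum_distrib_left sum_distrib_right mult.assoc) (rule sum.swap)
  also have "\<dots> = m a * (\<Sum>c\<in>C. M a c * l c)"
    using l(2) fin \<open>a \<in> A\<close> by (subst sum.remove[of A a]) auto
  finally have "(\<Sum>c\<in>C. M a c * l c) = 0" using nz by simp
  with l(2) have "\<And>b. b \<in> A \<Longrightarrow> (\<Sum>c\<in>C. M b c * l c) = 0" by blast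
  with inj l(1) show False by blast
qed

text \<open>Homogenisation: the right-hand side becomes the column of an extra unknown
  \<open>None\<close>. A nonzero solution of the larger system has a nonzero entry at
  \<open>None\<close>, because the kernel is trivial, and can be divided by it.\<close>

lemma trivial_kernel_surj:
  fixes M :: "'a \<Rightarrow> 'b \<Rightarrow> 'k::field"
  assumes fin: "finite A" "finite C" and card: "card A \<le> card C"
    and inj: "\<And>l. (\<And>a. a \<in> A \<Longrightarrow> (\<Sum>c\<in>C. M a c * l c) = 0) \<Longrightarrow> \<forall>c\<in>C. l c = 0"
  shows "\<exists>l. \<forall>a\<in>A. (\<Sum>c\<in>C. M a c * l c) = f a"
proof -
  define C' where "C' = insert None (Some ` C)"
  define M' where "M' = (\<lambda>a c. case c of None \<Rightarrow> - f a | Some c \<Rightarrow> M a c)"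
  have sum: "(\<Sum>c\<in>C'. M' a c * l c) = - f a * l None + (\<Sum>c\<in>C. M a c * l (Some c))" for a l
    unfolding C'_def using fin by (subst sum.insert) (auto simp: M'_def sum.reindex)
  have "card C' = Suc (card C)"
    unfolding C'_def using fin by (subst card_insert_disjoint) (auto simp: card_image)
  then obtain l where l: "\<exists>c\<in>C'. l c \<noteq> 0" "\<And>a. a \<in> A \<Longrightarrow> (\<Sum>c\<in>C'. M' a c * l c) = 0"
    using underdetermined_system[of A C' M'] fin card by (auto simp: C'_def)
  have "l None \<noteq> 0"
  proof
    assume 0: "l None = 0"
    with l(2) sum have "\<forall>c\<in>C. l (Some c) = 0" by (intro inj) auto
    with 0 l(1) show False by (auto simp: C'_def)
  qed
  then have "(\<Sum>c\<in>C. M a c * (l (Some c) / l None)) = f a" if "a \<in> A" for a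
    using l(2)[OF that] unfolding sum
    by (simp add: sum_divide_distrib[symmetric] eq_divide_eq divide_eq_eq mult.commute)
  then show ?thesis by (intro exI[of _ "\<lambda>c. l (Some c) / l None"]) blast
qed

section \<open>Counting words by degree over a graded alphabet\<close>

definition deg_words :: "('a \<Rightarrow> nat) \<Rightarrow> 'a set \<Rightarrow> nat \<Rightarrow> 'a list set" where
  "deg_words d X n = {w \<in> lists X. (\<Sum>x\<leftarrow>w. d x) = n}"

text \<open>For the free generators these words give a basis of the degree \<open>n\<close> part of
  the square of the augmentation ideal; for the cogenerators they are the words at which primitive
  elements have coordinate 0.\<close>

definition long_words :: "('a \<Rightarrow> nat) \<Rightarrow> 'a set \<Rightarrow> nat \<Rightarrow> 'a list set" where
  "long_words d X n = {w \<in> deg_words d X n. 2 \<le> length w}"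

text \<open>Cut off the first letter. Since letters have positive degree, what remains is non-empty
  exactly when the first letter has degree below \<open>n\<close>; this makes the count recursive in
  the degree.\<close>

lemma long_words_eq:
  assumes "\<forall>x\<in>X. 1 \<le> d x"
  shows "long_words d X n =
    (\<lambda>(k, x, w). x # w) ` (SIGMA k:{1..<n}. {x \<in> X. d x = k} \<times> deg_words d X (n - k))"
    (is "?l = ?r")
proof (intro equalityI subsetI)
  fix w assume w: "w \<in> ?l"
  then obtain x y v where v: "w = x # y # v" "x \<in> X" "y \<in> X" "v \<in> lists X"
    by (cases w; cases "tl w") (auto simp: long_words_def deg_words_def)
  with w assms have "1 \<le> d x" "1 \<le> d y" by auto
  with w v show "w \<in> ?r"
    by (intro image_eqI[of _ _ "(d x, x, y # v)"]) (auto simp: long_words_def deg_words_def)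
next
  fix w assume "w \<in> ?r"
  then obtain x v where "w = x # v" "x \<in> X" "d x < n" "v \<in> deg_words d X (n - d x)" by auto
  moreover from this have "v \<noteq> []" by (auto simp: deg_words_def)
  ultimately show "w \<in> ?l"
    by (cases v) (auto simp: long_words_def deg_words_def)
qed

lemma finite_letters:
  assumes "finite (deg_words d X n)"
  shows "finite {x \<in> X. d x = n}"
  by (rule finite_imageD[of "\<lambda>x. [x]"])
    (auto intro!: finite_subset[OF _ assms] inj_onI simp: deg_words_def)

lemma card_long_words:
  assumes "\<forall>x\<in>X. 1 \<le> d x" "\<forall>n. finite (deg_words d X n)"
  shows "card (long_words d X n) =
    (\<Sum>k\<in>{1..<n}. card {x \<in> X. d x = k} * card (deg_words d X (n - k)))"
  unfolding long_words_eq[OF assms(1)]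
  by (subst card_image)
    (auto intro!: inj_onI simp: card_SigmaI card_cartesian_product finite_letters assms)

lemma card_deg_words:
  assumes "\<forall>x\<in>X. 1 \<le> d x" "\<forall>n. finite (deg_words d X n)" "1 \<le> n"
  shows "card (deg_words d X n) = card {x \<in> X. d x = n} + card (long_words d X n)"
proof -
  let ?L = "(\<lambda>x. [x]) ` {x \<in> X. d x = n}"
  have "deg_words d X n = ?L \<union> long_words d X n"
  proof (intro equalityI subsetI)
    fix w assume "w \<in> deg_words d X n"
    with assms(3) show "w \<in> ?L \<union> long_words d X n"
      by (cases w; cases "tl w") (auto simp: deg_words_def long_words_def)
  qed (auto simp: deg_words_def long_words_def)
  also have "card (?L \<union> long_words d X n) = card ?L + card (long_words d X n)"
  proof (rule card_Un_disjoint)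
    show "finite ?L"
      using finite_letters assms(2) by (intro finite_imageI) blast
    show "finite (long_words d X n)"
      by (rule finite_subset[OF _ assms(2)[rule_format, of n]]) (auto simp: long_words_def)
    show "?L \<inter> long_words d X n = {}"
      by (auto simp: long_words_def)
  qed
  also have "card ?L = card {x \<in> X. d x = n}"
    by (rule card_image) (auto intro: inj_onI)
  finally show ?thesis .
qed

text \<open>The numbers of words determine the numbers of letters, by induction on the degree: the
  letters of degree \<open>n\<close> are the words of degree \<open>n\<close> that are not long, and
  the first-letter recursion counts the long ones from lower degrees.\<close>

lemma card_long_words_cong:
  assumes "\<forall>x\<in>X. 1 \<le> d x" "\<forall>n. finite (deg_words d X n)"
    and "\<forall>y\<in>Y. 1 \<le> d' y" "\<forall>n. finite (deg_words d' Y n)"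
    and eq: "\<And>n. card (deg_words d X n) = card (deg_words d' Y n)"
  shows "card (long_words d X n) = card (long_words d' Y n)"
proof -
  have "card {x \<in> X. d x = n} = card {y \<in> Y. d' y = n}" if "1 \<le> n" for n
    using that
  proof (induction n rule: less_induct)
    case (less n)
    have "card (long_words d X n) = card (long_words d' Y n)"
      unfolding card_long_words[OF assms(1,2)] card_long_words[OF assms(3,4)]
      by (rule sum.cong) (simp_all add: less.IH eq)
    then show ?case
      using eq[of n] card_deg_words[OF assms(1,2) less.prems] card_deg_words[OF assms(3,4) less.prems]
      by linarith
  qed
  then show ?thesis
    unfolding card_long_words[OF assms(1,2)] card_long_words[OF assms(3,4)]
    by (intro sum.cong) (simp_all add: eq)
qed

section \<open>Graded Hopf algebras in terms of bilinear forms\<close>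

text \<open>The pairing conditions are symmetric under exchanging the arguments, so one-sided
  notions and lemmas are stated once and applied to the transposed form for the other side.\<close>

definition flip :: "('a \<Rightarrow> 'a \<Rightarrow> 'k) \<Rightarrow> 'a \<Rightarrow> 'a \<Rightarrow> 'k" where
  "flip P x y = P y x"

lemma flip_flip [simp]: "flip (flip P) = P"
  by (simp add: flip_def fun_eq_iff)

lemma bilinear_form_flip [simp]: "bilinear_form sc (flip P) \<longleftrightarrow> bilinear_form sc P"
  by (auto simp: bilinear_form_def flip_def)

context graded_connected_hopf_algebra
begin

sublocale vector_space sc by (rule vs)

sublocale to_field: vector_space_pair sc "(*) :: 'k \<Rightarrow> 'k \<Rightarrow> 'k"
  by unfold_locales (simp_all add: algebra_simps)

sublocale endo: vector_space_pair sc sc ..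

abbreviation "linear_form \<equiv> Vector_Spaces.linear sc ((*) :: 'k \<Rightarrow> 'k \<Rightarrow> 'k)"
abbreviation "linear_map \<equiv> Vector_Spaces.linear sc sc"
abbreviation "bilin \<equiv> bilinear_form sc"

lemma linear_formI:
  assumes "\<And>x y. f (x + y) = f x + f y" "\<And>c x. f (sc c x) = c * f x"
  shows "linear_form f"
  using assms vs to_field.vs2.vector_space_axioms by (simp add: Vector_Spaces.linear_iff)

lemma linear_formD:
  assumes "linear_form f"
  shows "f (x + y) = f x + f y" "f (sc c x) = c * f x" "f 0 = 0" "f (x - y) = f x - f y"
    "f (sum g A) = (\<Sum>a\<in>A. f (g a))"
  by (rule to_field.linear_add[OF assms] to_field.linear_scale[OF assms] to_field.linear_0[OF assms]
    to_field.linear_diff[OF assms] to_field.linear_sum[OF assms])+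

lemma linear_mapD:
  assumes "linear_map f"
  shows "f (x + y) = f x + f y" "f (sc c x) = sc c (f x)"
  by (rule endo.linear_add[OF assms] endo.linear_scale[OF assms])+

lemma linear_form_sum_list:
  assumes "linear_form f"
  shows "f (\<Sum>(a, b)\<leftarrow>t. g a b) = (\<Sum>(a, b)\<leftarrow>t. f (g a b))"
  by (induction t) (auto simp: linear_formD(1-3)[OF assms])

lemma linear_form_eq_on_span:
  assumes "linear_form f" "linear_form g" "\<And>x. x \<in> A \<Longrightarrow> f x = g x" "x \<in> span A"
  shows "f x = g x"
  by (rule to_field.linear_eq_on[OF assms(1,2,4) assms(3)])

lemma linear_form_zero_on_span:
  assumes "linear_form f" "\<And>x. x \<in> A \<Longrightarrow> f x = 0" "x \<in> span A"
  shows "f x = 0"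
proof -
  have "linear_form (\<lambda>_. 0)" by (rule linear_formI) simp_all
  from linear_form_eq_on_span[OF assms(1) this assms(2,3)] show ?thesis by simp
qed

lemma linear_form_eqI:
  assumes "linear_form f" "linear_form g" "\<And>n x. x \<in> gr n \<Longrightarrow> f x = g x"
  shows "f x = g x"
  by (rule linear_form_eq_on_span[OF assms(1,2), of "\<Union>n. gr n"]) (use assms(3) in \<open>auto simp only: gr_span\<close>)

lemma bilin_linear:
  assumes "bilin f"
  shows "linear_form (\<lambda>x. f x y)" "linear_form (f y)"
  using assms by (auto simp: bilinear_form_def intro!: linear_formI)

lemma bilinI:
  assumes "\<And>y. linear_form (\<lambda>x. f x y)" "\<And>x. linear_form (f x)"
  shows "bilin f"
  unfolding bilinear_form_def
  by (intro allI conjI; rule linear_formD(1,2)[OF assms(1)] linear_formD(1,2)[OF assms(2)])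

lemma bilinD:
  assumes "bilin f"
  shows "f (x + y) z = f x z + f y z" "f z (x + y) = f z x + f z y"
    "f (sc c x) y = c * f x y" "f x (sc c y) = c * f x y" "f 0 x = 0" "f x 0 = 0"
    "f (x - y) z = f x z - f y z" "f z (x - y) = f z x - f z y"
  by (rule linear_formD(1-4)[OF bilin_linear(1)[OF assms]] linear_formD(1-4)[OF bilin_linear(2)[OF assms]])+

lemma bilin_tensor:
  assumes "linear_form f" "linear_form g"
  shows "bilin (\<lambda>a b. f a * g b)"
  unfolding bilinear_form_def
  by (simp add: linear_formD(1,2)[OF assms(1)] linear_formD(1,2)[OF assms(2)] distrib_left distrib_right)

lemma linear_form_cou: "linear_form cou"
  by (rule linear_formI) (simp_all add: cou_add cou_sc)

section \<open>Bilinear forms evaluated on coproducts\<close>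

definition cosum :: "('h \<Rightarrow> 'h \<Rightarrow> 'k) \<Rightarrow> 'h \<Rightarrow> 'k" where
  "cosum f x = (\<Sum>(a, b)\<leftarrow>cop x. f a b)"

text \<open>Bilinearity of \<open>f\<close> is what makes the sum independent of the list chosen to
  represent the coproduct.\<close>

lemma cosum_tensor_eq:
  assumes "bilin f" "tensor_eq sc (cop x) t"
  shows "cosum f x = (\<Sum>(a, b)\<leftarrow>t. f a b)"
  using assms by (simp add: cosum_def tensor_eq_def)

lemma cosum_cong:
  assumes "\<And>a b. f a b = g a b"
  shows "cosum f x = cosum g x"
  using assms by (simp add: cosum_def)

lemma cosum_scale: "cosum (\<lambda>a b. c * f a b) x = c * cosum f x"
  unfolding cosum_def
  by (simp add: case_prod_unfold sum_list_const_mult)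

lemma cosum_scale_right: "cosum (\<lambda>a b. f a b * c) x = cosum f x * c"
  using cosum_scale[of c f x] by (simp add: mult.commute)

lemma cosum_add: "cosum (\<lambda>a b. f a b + g a b) x = cosum f x + cosum g x"
  unfolding cosum_def by (simp add: case_prod_unfold sum_list_addf)

lemma cosum_swap: "cosum (\<lambda>a b. cosum (F a b) y) x = cosum (\<lambda>c d. cosum (\<lambda>a b. F a b c d) x) y"
proof -
  have "(\<Sum>p\<leftarrow>xs. \<Sum>q\<leftarrow>ys. G p q) = (\<Sum>q\<leftarrow>ys. \<Sum>p\<leftarrow>xs. (G p q :: 'k))"
    for xs ys :: "('h \<times> 'h) list" and G
    by (induction xs) (simp_all add: sum_list_addf)
  then show ?thesis unfolding cosum_def case_prod_unfold .
qed

lemma linear_form_cosum: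
  assumes "bilin f"
  shows "linear_form (cosum f)"
proof (rule linear_formI)
  show "cosum f (x + y) = cosum f x + cosum f y" for x y
    unfolding cosum_tensor_eq[OF assms cop_add] by (simp add: cosum_def)
  show "cosum f (sc c x) = c * cosum f x" for c x
    unfolding cosum_tensor_eq[OF assms cop_sc] cosum_scale[symmetric]
    by (simp add: cosum_def o_def case_prod_unfold bilinD[OF assms])
qed

text \<open>The list \<open>cop x\<close> itself need not consist of homogeneous tensors, but some
  list representing the same tensor does, and bilinear forms may be compared there.\<close>

lemma cosum_homogeneous_cong:
  assumes "x \<in> gr n" "bilin f" "bilin g"
    and "\<And>i j a b. i + j = n \<Longrightarrow> a \<in> gr i \<Longrightarrow> b \<in> gr j \<Longrightarrow> f a b = g a b"
  shows "cosum f x = cosum g x"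
proof -
  obtain t where t: "tensor_eq sc (cop x) t"
    "\<forall>(a, b)\<in>set t. \<exists>i j. i + j = n \<and> a \<in> gr i \<and> b \<in> gr j"
    using cop_homog[OF assms(1)] by blast
  show ?thesis
    unfolding cosum_tensor_eq[OF assms(2) t(1)] cosum_tensor_eq[OF assms(3) t(1)]
    by (rule arg_cong[of _ _ sum_list], rule map_cong[OF refl]) (use t(2) assms(4) in fastforce)
qed

lemma cosum_mult:
  assumes "bilin f"
  shows "cosum f (mult x y) = cosum (\<lambda>a b. cosum (\<lambda>c d. f (mult a c) (mult b d)) y) x"
proof -
  have "(\<Sum>(a, b)\<leftarrow>concat (map (\<lambda>(a, b). map (\<lambda>(c, d). (mult a c, mult b d)) s) t). f a b)
      = (\<Sum>(a, b)\<leftarrow>t. \<Sum>(c, d)\<leftarrow>s. f (mult a c) (mult b d))" for s t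
    by (induction t) (auto simp: o_def case_prod_unfold)
  then show ?thesis
    unfolding cosum_tensor_eq[OF assms cop_mult] by (simp add: cosum_def)
qed

lemma cosum_coassoc:
  assumes "linear_form f" "linear_form g" "linear_form h"
  shows "cosum (\<lambda>a b. cosum (\<lambda>c d. f c * g d) a * h b) x = cosum (\<lambda>a b. f a * cosum (\<lambda>c d. g c * h d) b) x"
proof -
  have "trilinear_form sc (\<lambda>a b c. f a * g b * h c)"
    unfolding trilinear_form_def
    by (simp only: linear_formD(1,2)[OF assms(1)] linear_formD(1,2)[OF assms(2)]
        linear_formD(1,2)[OF assms(3)] distrib_left distrib_right mult_ac simp_thms)
  from coassoc[OF this, of x]
  have "cosum (\<lambda>a b. cosum (\<lambda>c d. f c * g d * h b) a) x = cosum (\<lambda>a b. cosum (\<lambda>c d. f a * (g c * h d)) b) x"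
    unfolding cosum_def mult.assoc[symmetric] .
  then show ?thesis by (simp only: cosum_scale cosum_scale_right)
qed

lemma cosum_counit_left:
  assumes "linear_form f"
  shows "cosum (\<lambda>a b. cou a * f b) x = f x"
proof -
  have "f (\<Sum>(a, b)\<leftarrow>cop x. sc (cou a) b) = cosum (\<lambda>a b. cou a * f b) x"
    unfolding linear_form_sum_list[OF assms] cosum_def by (simp add: linear_formD(1,2)[OF assms])
  then show ?thesis by (simp add: counit_left)
qed

lemma cosum_counit_right:
  assumes "linear_form f"
  shows "cosum (\<lambda>a b. f a * cou b) x = f x"
proof -
  have "f (\<Sum>(a, b)\<leftarrow>cop x. sc (cou b) a) = cosum (\<lambda>a b. f a * cou b) x"
    unfolding linear_form_sum_list[OF assms] cosum_def by (simp add: linear_formD(1,2)[OF assms] mult.commute)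
  then show ?thesis by (simp add: counit_right)
qed

lemma cosum_prim:
  assumes "bilin f" "x \<in> prim sc one cop"
  shows "cosum f x = f x one + f one x"
  using cosum_tensor_eq[OF assms(1), of x "[(x, one), (one, x)]"] assms(2) by (simp add: prim_def)

lemma linear_form_mult:
  assumes "linear_form f"
  shows "linear_form (\<lambda>x. f (mult x y))" "linear_form (\<lambda>x. f (mult y x))"
  by (rule linear_formI; simp add: linear_formD(1,2)[OF assms] mult_add_left mult_add_right
      mult_sc_left mult_sc_right)+

section \<open>Homogeneous bases, components and projections\<close>

lemma gr_disjoint:
  assumes "x \<in> gr i" "x \<in> gr j" "i \<noteq> j"
  shows "x = 0"
proof -
  have "- x \<in> gr j" using assms gr_subspace subspace_neg by blast
  then have "\<forall>n\<in>{i, j}. (if n = i then x else - x) = 0"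
    using assms by (intro gr_indep) auto
  then show ?thesis by auto
qed

lemma one_gr: "one \<in> gr 0"
  unfolding gr0 by (rule range_eqI[of _ _ 1]) simp

text \<open>Group the expansion of \<open>x\<close> by degree and move \<open>x\<close> into the
  group of degree \<open>n\<close>. The groups sum to 0 and lie in distinct components, so each
  vanishes; in a degree other than \<open>n\<close> the independence of \<open>E\<close> then kills
  the coefficients.\<close>

lemma representation_homogeneous:
  assumes E: "independent E" "span E = UNIV" "\<And>e. e \<in> E \<Longrightarrow> e \<in> gr (d e)"
    and x: "x \<in> gr n" and "e \<in> E" "d e \<noteq> n"
  shows "representation E x e = 0"
proof (rule ccontr)
  assume ne: "representation E x e \<noteq> 0"
  let ?r = "representation E x"
  define F where "F = {e. ?r e \<noteq> 0}"
  have F: "finite F" "F \<subseteq> E"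
    using finite_representation representation_ne_zero by (auto simp: F_def)
  define y where "y k = (\<Sum>e\<in>{e\<in>F. d e = k}. sc (?r e) e) - (if k = n then x else 0)" for k
  have "(\<Sum>k\<in>insert n (d ` F). \<Sum>e\<in>{e\<in>F. d e = k}. sc (?r e) e) = (\<Sum>e\<in>F. sc (?r e) e)"
    using F by (intro sum.group) auto
  also have "\<dots> = x"
    unfolding F_def using E by (intro sum_nonzero_representation_eq) auto
  finally have "(\<Sum>k\<in>insert n (d ` F). y k) = 0"
    using F by (simp add: y_def sum_subtractf)
  moreover have "\<forall>k\<in>insert n (d ` F). y k \<in> gr k"
    using F E(3) x unfolding y_def
    by (intro ballI subspace_diff[OF gr_subspace] subspace_sum[OF gr_subspace] subspace_scale[OF gr_subspace])
      (auto simp: subspace_0[OF gr_subspace])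
  ultimately have "\<forall>k\<in>insert n (d ` F). y k = 0"
    using F by (intro gr_indep) auto
  then have "(\<Sum>e\<in>{e'\<in>F. d e' = d e}. sc (?r e) e) = 0"
    using ne \<open>d e \<noteq> n\<close> by (auto simp: y_def F_def)
  then have "?r e = 0"
    using independentD[OF E(1), of "{e'\<in>F. d e' = d e}" ?r e] F ne by (auto simp: F_def)
  with ne show False ..
qed

lemma gr_eq_span:
  assumes E: "independent E" "span E = UNIV" "\<And>e. e \<in> E \<Longrightarrow> e \<in> gr (d e)"
  shows "gr n = span {e \<in> E. d e = n}"
proof
  show "span {e \<in> E. d e = n} \<subseteq> gr n"
    by (rule span_minimal[OF _ gr_subspace]) (use E in auto)
  show "gr n \<subseteq> span {e \<in> E. d e = n}"
  proof
    fix x assume x: "x \<in> gr n"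
    have "x = (\<Sum>e | representation E x e \<noteq> 0. sc (representation E x e) e)"
      using E by (simp add: sum_nonzero_representation_eq)
    also have "\<dots> \<in> span {e \<in> E. d e = n}"
      using representation_homogeneous[OF E x] representation_ne_zero
      by (intro span_sum span_scale span_base) blast
    finally show "x \<in> span {e \<in> E. d e = n}" .
  qed
qed

text \<open>Keep the basis elements of degree \<open>n\<close> and kill the others. The projection
  serves to change a form in degree \<open>n\<close> alone and to extract the degree
  \<open>n\<close> part of the square of the augmentation ideal.\<close>

lemma homogeneous_projection:
  assumes E: "independent E" "span E = UNIV" "\<And>e. e \<in> E \<Longrightarrow> e \<in> gr (d e)"
  obtains p where "linear_map p" "\<And>x. x \<in> gr n \<Longrightarrow> p x = x"
    "\<And>k x. k \<noteq> n \<Longrightarrow> x \<in> gr k \<Longrightarrow> p x = 0" "\<And>x. p x \<in> gr n"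
proof -
  define p where "p = endo.construct E (\<lambda>e. if d e = n then e else 0)"
  have lin: "linear_map p" unfolding p_def by (rule endo.linear_construct[OF E(1)])
  have p: "p e = (if d e = n then e else 0)" if "e \<in> E" for e
    unfolding p_def by (rule endo.construct_basis[OF E(1) that])
  have gr: "gr k = span {e \<in> E. d e = k}" for k
    by (rule gr_eq_span) (use E in auto)
  have id: "p x = x" if "x \<in> gr n" for x
    using that[unfolded gr] endo.linear_eq_on[OF lin linear_id, of x "{e \<in> E. d e = n}"] p by auto
  have zero: "p x = 0" if "k \<noteq> n" "x \<in> gr k" for k x
    using that(1) that(2)[unfolded gr]
      endo.linear_eq_on[OF lin endo.linear_zero, of x "{e \<in> E. d e = k}"] p by auto
  have "p x \<in> gr n" for x
  proof -
    have "p x \<in> span ((\<lambda>e. if d e = n then e else 0) ` E)"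
      unfolding p_def by (rule endo.construct_in_span[OF E(1)])
    also have "\<dots> \<subseteq> gr n"
      by (rule span_minimal[OF _ gr_subspace]) (use E subspace_0[OF gr_subspace] in auto)
    finally show ?thesis .
  qed
  with lin id zero show ?thesis using that by blast
qed

text \<open>By injectivity a basis element determines its word, and thereby a degree. This covers
  both the products of free generators and the deconcatenation basis.\<close>

lemma gr_eq_span_words:
  assumes f: "inj_on f (lists X)" "independent (f ` lists X)" "span (f ` lists X) = UNIV"
    and d: "\<And>w. w \<in> lists X \<Longrightarrow> f w \<in> gr (\<Sum>x\<leftarrow>w. d x)"
  shows "gr n = span (f ` deg_words d X n)"
proof -
  define d' where "d' = (\<lambda>e. \<Sum>x\<leftarrow>inv_into (lists X) f e. d x)"
  have d': "d' (f w) = (\<Sum>x\<leftarrow>w. d x)" if "w \<in> lists X" for w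
    unfolding d'_def inv_into_f_f[OF f(1) that] ..
  have "gr n = span {e \<in> f ` lists X. d' e = n}"
  proof (rule gr_eq_span[OF f(2,3)])
    fix e assume "e \<in> f ` lists X"
    then obtain w where w: "w \<in> lists X" "e = f w" by blast
    show "e \<in> gr (d' e)" unfolding w(2) d'[OF w(1)] by (rule d[OF w(1)])
  qed
  also have "{e \<in> f ` lists X. d' e = n} = f ` deg_words d X n"
  proof (intro equalityI subsetI)
    fix e assume e: "e \<in> {e \<in> f ` lists X. d' e = n}"
    then obtain w where w: "w \<in> lists X" "e = f w" by blast
    with e show "e \<in> f ` deg_words d X n" using d'[OF w(1)] by (auto simp: deg_words_def)
  next
    fix e assume "e \<in> f ` deg_words d X n"
    then obtain w where w: "w \<in> lists X" "e = f w" "(\<Sum>x\<leftarrow>w. d x) = n" by (auto simp: deg_words_def)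
    then show "e \<in> {e \<in> f ` lists X. d' e = n}" using d'[OF w(1)] by auto
  qed
  finally show ?thesis .
qed

text \<open>The alphabet may be infinite; finiteness in each degree comes from the finite dimension
  of \<open>gr n\<close>.\<close>

lemma finite_deg_words:
  assumes f: "inj_on f (lists X)" "independent (f ` lists X)" "span (f ` lists X) = UNIV"
    and d: "\<And>w. w \<in> lists X \<Longrightarrow> f w \<in> gr (\<Sum>x\<leftarrow>w. d x)"
  shows "finite (deg_words d X n)"
proof -
  obtain F where F: "finite F" "span F = gr n" using gr_findim by blast
  have sub: "deg_words d X n \<subseteq> lists X" by (auto simp: deg_words_def)
  have "f ` deg_words d X n \<subseteq> span F"
    unfolding F(2) using d by (auto simp: deg_words_def)
  then have "finite (f ` deg_words d X n)"
    using independent_span_bound[OF F(1) independent_mono[OF f(2) image_mono[OF sub]]] by blast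
  then show ?thesis
    by (rule finite_imageD) (rule inj_on_subset[OF f(1) sub])
qed

text \<open>A basis of \<open>S\<close> is extended by elements of \<open>G\<close> to a basis of
  the sum of \<open>S\<close> and \<open>G\<close>; \<open>p\<close> and \<open>q\<close> keep the
  old and the new basis elements respectively. As \<open>S\<close> and \<open>G\<close> may
  intersect, \<open>p\<close> need not vanish on \<open>G\<close>.\<close>

lemma adapted_projections:
  assumes S: "subspace S" and G: "subspace G"
  obtains p q where "linear_map p" "linear_map q" "\<And>x. p x \<in> S" "\<And>x. q x \<in> G"
    "\<And>x. x \<in> S \<Longrightarrow> p x = x" "\<And>x. x \<in> S \<Longrightarrow> q x = 0" "\<And>x. x \<in> G \<Longrightarrow> p x + q x = x"
proof -
  obtain A where A: "A \<subseteq> S" "independent A" "S \<subseteq> span A"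
    using maximal_independent_subset[of S] by blast
  have spanA: "span A = S"
    using A span_minimal[OF A(1) S] by blast
  obtain A' where A': "A \<subseteq> A'" "A' \<subseteq> S \<union> G" "independent A'" "S \<union> G \<subseteq> span A'"
    using maximal_independent_subset_extend[of A "S \<union> G"] A by blast
  \<comment> \<open>A basis element outside \<open>G\<close> would lie in \<open>S\<close>, hence
    already in the span of \<open>A\<close>.\<close>
  have AG: "a \<in> G" if "a \<in> A' - A" for a
  proof (rule ccontr)
    assume "a \<notin> G"
    with that A' have "a \<in> span A" by (auto simp: spanA)
    then have "a \<in> span (A' - {a})"
      using span_mono[of A "A' - {a}"] A'(1) that by blast
    with A'(3) that show False unfolding dependent_def by blast
  qed
  define p where "p = endo.construct A' (\<lambda>a. if a \<in> A then a else 0)"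
  define q where "q = endo.construct A' (\<lambda>a. if a \<in> A then 0 else a)"
  have lin: "linear_map p" "linear_map q"
    unfolding p_def q_def by (rule endo.linear_construct[OF A'(3)])+
  have basis: "p a = (if a \<in> A then a else 0)" "q a = (if a \<in> A then 0 else a)" if "a \<in> A'" for a
    unfolding p_def q_def by (rule endo.construct_basis[OF A'(3) that])+
  show ?thesis
  proof (rule that[OF lin])
    fix x
    have "p x \<in> span ((\<lambda>a. if a \<in> A then a else 0) ` A')"
      unfolding p_def by (rule endo.construct_in_span[OF A'(3)])
    also have "\<dots> \<subseteq> S"
      by (rule span_minimal[OF _ S]) (use A subspace_0[OF S] in auto)
    finally show "p x \<in> S" .
    have "q x \<in> span ((\<lambda>a. if a \<in> A then 0 else a) ` A')"
      unfolding q_def by (rule endo.construct_in_span[OF A'(3)])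
    also have "\<dots> \<subseteq> G"
      by (rule span_minimal[OF _ G]) (use AG subspace_0[OF G] in auto)
    finally show "q x \<in> G" .
    have inA: "a \<in> A'" if "a \<in> A" for a using that A'(1) by blast
    show "p x = x" if "x \<in> S"
      using endo.linear_eq_on[OF lin(1) linear_id, of x A] that A(3) basis(1)[OF inA] by auto
    show "q x = 0" if "x \<in> S"
      using endo.linear_eq_on[OF lin(2) endo.linear_zero, of x A] that A(3) basis(2)[OF inA] by auto
    have "linear_map (\<lambda>x. p x + q x)" by (rule endo.linear_compose_add[OF lin])
    then show "p x + q x = x" if "x \<in> G"
      using endo.linear_eq_on[OF _ linear_id, of "\<lambda>x. p x + q x" x A'] that A'(4) basis by auto
  qed
qed

lemma homogeneous_decomposition:
  obtains N f where "finite N" "\<And>k. k \<in> N \<Longrightarrow> f k \<in> gr k" "x = (\<Sum>k\<in>N. f k)"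
proof -
  have "x \<in> span (\<Union>n. gr n)" by (simp only: gr_span UNIV_I)
  then obtain t r where t: "finite t" "t \<subseteq> (\<Union>n. gr n)" "x = (\<Sum>a\<in>t. sc (r a) a)"
    unfolding span_explicit by blast
  define d where "d a = (SOME n. a \<in> gr n)" for a
  have d: "a \<in> gr (d a)" if "a \<in> t" for a
    unfolding d_def using t(2) that by (intro someI_ex[of "\<lambda>n. a \<in> gr n"]) blast
  show ?thesis
  proof (rule that[of "d ` t" "\<lambda>k. \<Sum>a\<in>{a\<in>t. d a = k}. sc (r a) a"])
    show "(\<Sum>a\<in>{a\<in>t. d a = k}. sc (r a) a) \<in> gr k" for k
      using d by (intro subspace_sum[OF gr_subspace] subspace_scale[OF gr_subspace]) auto
    show "x = (\<Sum>k\<in>d ` t. \<Sum>a\<in>{a\<in>t. d a = k}. sc (r a) a)"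
      unfolding t(3) by (rule sum.group[symmetric]) (use t(1) in auto)
  qed (use t(1) in simp)
qed

end

section \<open>Partial pairings on a free Hopf algebra\<close>

context graded_connected_hopf_algebra
begin

definition homogeneous_form :: "('h \<Rightarrow> 'h \<Rightarrow> 'k) \<Rightarrow> bool" where
  "homogeneous_form P \<longleftrightarrow> (\<forall>i j x y. i \<noteq> j \<longrightarrow> x \<in> gr i \<longrightarrow> y \<in> gr j \<longrightarrow> P x y = 0)"

text \<open>By homogeneity both sides vanish unless the degrees of \<open>y\<close> and \<open>z\<close> add up to \<open>k\<close>, so only
  values of \<open>P\<close> in degrees below \<open>n\<close> are constrained although \<open>y\<close> and \<open>z\<close> are arbitrary.\<close>

definition right_multiplicative :: "nat \<Rightarrow> ('h \<Rightarrow> 'h \<Rightarrow> 'k) \<Rightarrow> bool" where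
  "right_multiplicative n P \<longleftrightarrow>
     (\<forall>k<n. \<forall>x\<in>gr k. \<forall>y z. P x (mult y z) = cosum (\<lambda>a b. P a y * P b z) x)"

text \<open>\<open>P\<close> is a form on the whole of H; from degree \<open>n\<close> on, the
  multiplicative identities are not imposed and its values are placeholders, replaced one degree at
  a time.\<close>

definition partial_pairing :: "nat \<Rightarrow> ('h \<Rightarrow> 'h \<Rightarrow> 'k) \<Rightarrow> bool" where
  "partial_pairing n P \<longleftrightarrow> bilin P \<and> homogeneous_form P \<and> (\<forall>x. P one x = cou x)
     \<and> (\<forall>x. P x one = cou x) \<and> right_multiplicative n P \<and> right_multiplicative n (flip P)"

lemma homogeneous_form_flip: "homogeneous_form P \<Longrightarrow> homogeneous_form (flip P)"
  unfolding homogeneous_form_def flip_def by metis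

lemma partial_pairing_flip: "partial_pairing n P \<Longrightarrow> partial_pairing n (flip P)"
  by (simp add: partial_pairing_def homogeneous_form_flip) (simp add: flip_def)

lemma partial_pairingD:
  assumes "partial_pairing n P"
  shows "bilin P" "homogeneous_form P" "P one x = cou x" "P x one = cou x"
    "right_multiplicative n P" "right_multiplicative n (flip P)"
  using assms by (auto simp: partial_pairing_def)

lemma homogeneous_formD:
  assumes "homogeneous_form P" "i \<noteq> j" "x \<in> gr i" "y \<in> gr j"
  shows "P x y = 0"
  using assms by (auto simp: homogeneous_form_def)

lemma right_multiplicativeD:
  assumes "right_multiplicative n P" "k < n" "x \<in> gr k"
  shows "P x (mult y z) = cosum (\<lambda>a b. P a y * P b z) x"
  using assms by (auto simp: right_multiplicative_def)

lemma bilin_pair: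
  assumes "bilin P" "bilin Q"
  shows "bilin (\<lambda>a b. P a y * Q b z)"
  by (rule bilin_tensor[OF bilin_linear(1)[OF assms(1)] bilin_linear(1)[OF assms(2)]])

lemma linear_form_cosum_param:
  assumes "bilin P"
  shows "linear_form (\<lambda>y. cosum (\<lambda>a b. P a y * g b) x)"
    "linear_form (\<lambda>y. cosum (\<lambda>a b. f a * P b y) x)"
proof -
  show "linear_form (\<lambda>y. cosum (\<lambda>a b. P a y * g b) x)"
    by (rule linear_formI)
      (simp_all only: bilinD[OF assms] distrib_right cosum_add cosum_scale mult.assoc)
  have "cosum (\<lambda>a b. f a * (c * P b y)) x = cosum (\<lambda>a b. c * (f a * P b y)) x" for c y
    by (rule cosum_cong) (rule mult.left_commute)
  then show "linear_form (\<lambda>y. cosum (\<lambda>a b. f a * P b y) x)"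
    by (intro linear_formI) (simp_all only: bilinD[OF assms] distrib_left cosum_add cosum_scale)
qed

text \<open>A left argument of degree \<open>n\<close>, where the forms may differ, is orthogonal to
  \<open>y\<close> for both of them.\<close>

lemma homogeneous_agree_right:
  assumes "bilin P" "bilin P'" "homogeneous_form P" "homogeneous_form P'"
    and "\<And>k x y. k \<noteq> n \<Longrightarrow> x \<in> gr k \<Longrightarrow> P' x y = P x y" and "k \<noteq> n" "y \<in> gr k"
  shows "P' x y = P x y"
proof (rule linear_form_eqI[OF bilin_linear(1)[OF assms(2)] bilin_linear(1)[OF assms(1)]])
  fix m x assume "x \<in> gr m"
  then show "P' x y = P x y"
    using assms(5)[of m x y] homogeneous_formD[OF assms(3), of m k x y]
      homogeneous_formD[OF assms(4), of m k x y] assms(6,7)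
    by (cases "m = n") auto
qed

text \<open>In degree \<open>n\<close> only products of two factors of positive degree carry
  information: a factor of degree 0 is a scalar and is handled by the counit, and degrees not adding
  up to \<open>n\<close> give 0 on both sides. The remaining case is the assumption
  \<open>top\<close>, whose right-hand side is computed with the old form.\<close>

lemma right_multiplicative_extend:
  assumes P: "partial_pairing n P" and P': "bilin P'" "homogeneous_form P'" "\<And>x. P' x one = cou x"
    and agree: "\<And>k x y. k \<noteq> n \<Longrightarrow> x \<in> gr k \<Longrightarrow> P' x y = P x y"
    and top: "\<And>i j x y z. x \<in> gr n \<Longrightarrow> 1 \<le> i \<Longrightarrow> 1 \<le> j \<Longrightarrow> i + j = n \<Longrightarrow> y \<in> gr i \<Longrightarrow> z \<in> gr j
      \<Longrightarrow> P' x (mult y z) = cosum (\<lambda>a b. P a y * P b z) x"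
  shows "right_multiplicative (Suc n) P'"
  unfolding right_multiplicative_def
proof (intro allI impI ballI)
  note bP = partial_pairingD(1)[OF P] and hP = partial_pairingD(2)[OF P]
  note P'P' = bilin_pair[OF P'(1) P'(1)] and PP = bilin_pair[OF bP bP]
  fix k x y z assume k: "k < Suc n" and x: "x \<in> gr k"
  show "P' x (mult y z) = cosum (\<lambda>a b. P' a y * P' b z) x"
  proof (cases "k = n")
    case False
    then have "k < n" using k by simp
    have "cosum (\<lambda>a b. P' a y * P' b z) x = cosum (\<lambda>a b. P a y * P b z) x"
    proof (rule cosum_homogeneous_cong[OF x P'P' PP])
      fix i j a b assume "i + j = k" "a \<in> gr i" "b \<in> gr j"
      then show "P' a y * P' b z = P a y * P b z"
        using agree[of i a y] agree[of j b z] \<open>k < n\<close> by simp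
    qed
    also have "\<dots> = P x (mult y z)"
      by (rule right_multiplicativeD[OF partial_pairingD(5)[OF P] \<open>k < n\<close> x, symmetric])
    finally show ?thesis using agree[OF False x] by simp
  next
    case True
    have lin1: "linear_form (\<lambda>y. P' x (mult y z))" "linear_form (\<lambda>z. P' x (mult y z))" for y z
      by (rule linear_form_mult[OF bilin_linear(2)[OF P'(1)]])+
    have lin2: "linear_form (\<lambda>y. cosum (\<lambda>a b. P' a y * P' b z) x)"
      "linear_form (\<lambda>z. cosum (\<lambda>a b. P' a y * P' b z) x)" for y z
      by (rule linear_form_cosum_param[OF P'(1)])+
    show ?thesis
    proof (rule linear_form_eqI[OF lin1(1) lin2(1)], rule linear_form_eqI[OF lin1(2) lin2(2)])
      fix i j y z assume yz: "y \<in> gr i" "z \<in> gr j"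
      consider "i = 0" | "j = 0" | "i + j \<noteq> n" | "1 \<le> i" "1 \<le> j" "i + j = n" by linarith
      then show "P' x (mult y z) = cosum (\<lambda>a b. P' a y * P' b z) x"
      proof cases
        case 1
        then obtain c where c: "y = sc c one" using yz(1) by (auto simp: gr0)
        have "cosum (\<lambda>a b. P' a y * P' b z) x = c * cosum (\<lambda>a b. P' a one * P' b z) x"
          unfolding c by (rule linear_formD(2)[OF lin2(1)])
        then show ?thesis
          by (simp only: P'(3) cosum_counit_left[OF bilin_linear(1)[OF P'(1)]])
            (simp only: c mult_sc_left mult_one_left bilinD(4)[OF P'(1)])
      next
        case 2
        then obtain c where c: "z = sc c one" using yz(2) by (auto simp: gr0)
        have "cosum (\<lambda>a b. P' a y * P' b z) x = c * cosum (\<lambda>a b. P' a y * P' b one) x"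
          unfolding c by (rule linear_formD(2)[OF lin2(2)])
        then show ?thesis
          by (simp only: P'(3) cosum_counit_right[OF bilin_linear(1)[OF P'(1)]])
            (simp only: c mult_sc_right mult_one_right bilinD(4)[OF P'(1)])
      next
        case 3
        \<comment> \<open>The zero form is written as a multiple so that \<open>cosum_scale\<close>
          evaluates its sum.\<close>
        have "cosum (\<lambda>a b. P' a y * P' b z) x = cosum (\<lambda>a b. 0 * (P' a y * P' b z)) x"
        proof (rule cosum_homogeneous_cong[OF x P'P'])
          show "bilin (\<lambda>a b. 0 * (P' a y * P' b z))" by (simp add: bilinear_form_def)
          fix p q a b assume "p + q = k" "a \<in> gr p" "b \<in> gr q"
          with 3 True show "P' a y * P' b z = 0 * (P' a y * P' b z)"
            using homogeneous_formD[OF P'(2) _ \<open>a \<in> gr p\<close> yz(1)]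
              homogeneous_formD[OF P'(2) _ \<open>b \<in> gr q\<close> yz(2)] by (cases "p = i") auto
        qed
        also have "\<dots> = 0" by (simp only: cosum_scale) simp
        finally show ?thesis
          using homogeneous_formD[OF P'(2) _ x mult_homog[OF yz]] 3 True by simp
      next
        case 4
        have "P' x (mult y z) = cosum (\<lambda>a b. P a y * P b z) x"
          using top x True 4 yz by blast
        also have "\<dots> = cosum (\<lambda>a b. P' a y * P' b z) x"
        proof (rule cosum_homogeneous_cong[OF x PP P'P'])
          fix p q a b assume pq: "p + q = k" "a \<in> gr p" "b \<in> gr q"
          \<comment> \<open>The two forms can differ only on a factor of degree \<open>n\<close>;
            then the other factor has degree 0 and is orthogonal to \<open>y\<close> or
            \<open>z\<close>, which have positive degree.\<close>
          consider "p \<noteq> n" "q \<noteq> n" | "p = 0" | "q = 0" using pq True by linarith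
          then show "P a y * P b z = P' a y * P' b z"
          proof cases
            case 1
            then show ?thesis using agree pq by simp
          next
            case 2
            then show ?thesis
              using homogeneous_formD[OF P'(2) _ pq(2) yz(1)] homogeneous_formD[OF hP _ pq(2) yz(1)] 4 by simp
          next
            case 3
            then show ?thesis
              using homogeneous_formD[OF P'(2) _ pq(3) yz(2)] homogeneous_formD[OF hP _ pq(3) yz(2)] 4 by simp
          qed
        qed
        finally show ?thesis .
      qed
    qed
  qed
qed

end

section \<open>Words in the free generators\<close>

locale free_hopf_algebra = graded_connected_hopf_algebra +
  fixes B :: "'b set"
  assumes letters: "B \<subseteq> (\<Union>n. gr n)"
    and inj_word: "inj_on (word mult one) (lists B)"
    and indep_words: "\<not> module.dependent sc (word mult one ` lists B)"
    and span_words: "module.span sc (word mult one ` lists B) = UNIV"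
begin

abbreviation "wd \<equiv> word mult one"
abbreviation "words \<equiv> wd ` lists B"

definition ldeg :: "'b \<Rightarrow> nat" where "ldeg b = (THE n. b \<in> gr n)"

abbreviation "wdeg w \<equiv> \<Sum>b\<leftarrow>w. ldeg b"

lemma word_Nil [simp]: "wd [] = one"
  and word_Cons: "wd (b # w) = mult b (wd w)"
  by (simp_all add: word_def)

lemma word_append: "wd (u @ v) = mult (wd u) (wd v)"
  by (induction u) (simp_all add: word_Cons mult_assoc mult_one_left)

text \<open>A letter is nonzero as a basis element, so its degree is unique. Degree 0 is excluded
  because the empty word \<open>one\<close> is another basis element, of which the letter would be a
  multiple.\<close>

lemma letter_deg:
  assumes "b \<in> B"
  shows "b \<in> gr (ldeg b)" "1 \<le> ldeg b"
proof -
  have b: "b = wd [b]" by (simp add: word_Cons mult_one_right)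
  have "b \<in> words" by (rule image_eqI[of b wd "[b]", OF b]) (simp add: assms)
  have "b \<noteq> 0"
  proof
    assume "b = 0"
    with \<open>b \<in> words\<close> have "dependent words" by (intro dependent_zero) (simp only:)
    with indep_words show False by contradiction
  qed
  obtain n where "b \<in> gr n" using assms letters by blast
  then have "ldeg b = n"
    unfolding ldeg_def by (rule the_equality) (use gr_disjoint[of b _ n] \<open>b \<in> gr n\<close> \<open>b \<noteq> 0\<close> in auto)
  then show "b \<in> gr (ldeg b)" using \<open>b \<in> gr n\<close> by simp
  show "1 \<le> ldeg b"
  proof (rule ccontr)
    assume "\<not> 1 \<le> ldeg b"
    then have "b \<in> gr 0" using \<open>b \<in> gr (ldeg b)\<close> by (simp add: not_le)
    then obtain c where c: "b = sc c one" unfolding gr0 by blast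
    have "wd [b] \<noteq> wd []" using inj_onD[OF inj_word, of "[b]" "[]"] assms by auto
    then have "b \<noteq> one" by (simp add: word_Cons mult_one_right)
    moreover have "one \<in> words" by (rule image_eqI[of _ _ "[]"]) simp_all
    ultimately have "one \<in> span (words - {b})" by (intro span_base) blast
    then have "sc c one \<in> span (words - {b})" by (rule span_scale)
    then have "b \<in> span (words - {b})" by (simp only: c[symmetric])
    then show False using indep_words[unfolded dependent_def] \<open>b \<in> words\<close> by blast
  qed
qed

lemma word_homogeneous: "w \<in> lists B \<Longrightarrow> wd w \<in> gr (wdeg w)"
  by (induction w) (auto simp: word_Cons one_gr intro: mult_homog letter_deg)

definition unword :: "'b \<Rightarrow> 'b list" where "unword = inv_into (lists B) wd"

lemma unword_word: "w \<in> lists B \<Longrightarrow> unword (wd w) = w"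
  unfolding unword_def by (rule inv_into_f_f[OF inj_word])

lemma gr_words: "gr n = span (wd ` deg_words ldeg B n)"
  by (rule gr_eq_span_words[OF inj_word indep_words span_words]) (rule word_homogeneous)

lemma gr_projection:
  obtains p where "linear_map p" "\<And>x. x \<in> gr n \<Longrightarrow> p x = x"
    "\<And>k x. k \<noteq> n \<Longrightarrow> x \<in> gr k \<Longrightarrow> p x = 0" "\<And>x. p x \<in> gr n"
proof (rule homogeneous_projection[OF indep_words span_words])
  fix z assume "z \<in> words"
  then obtain w where w: "w \<in> lists B" "z = wd w" by blast
  show "z \<in> gr (wdeg (unword z))"
    unfolding w(2) unword_word[OF w(1)] by (rule word_homogeneous[OF w(1)])
qed (rule that)

text \<open>The only candidate for \<open>P x\<close> on products. Its values on words of length at most one are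
  irrelevant (on the empty word they involve \<open>hd []\<close>).\<close>

definition rform :: "('b \<Rightarrow> 'b \<Rightarrow> 'a) \<Rightarrow> 'b \<Rightarrow> 'b \<Rightarrow> 'a" where
  "rform P x = to_field.construct words
     (\<lambda>e. cosum (\<lambda>u v. P u (hd (unword e)) * P v (wd (tl (unword e)))) x)"

lemma rform_word:
  assumes "b \<in> B" "w \<in> lists B"
  shows "rform P x (wd (b # w)) = cosum (\<lambda>u v. P u b * P v (wd w)) x"
proof -
  have w: "b # w \<in> lists B" using assms by simp
  show ?thesis
    unfolding rform_def
    by (subst to_field.construct_basis[OF indep_words imageI[OF w]]) (simp add: unword_word[OF w])
qed

lemma bilin_rform:
  assumes "bilin P"
  shows "bilin (rform P)"
proof (rule bilinI)
  show "linear_form (rform P x)" for x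
    unfolding rform_def by (rule to_field.linear_construct[OF indep_words])
  show "linear_form (\<lambda>x. rform P x y)" for y
    by (rule linear_formI)
      (simp_all only: rform_def linear_formD(1,2)[OF linear_form_cosum[OF bilin_pair[OF assms assms]]]
        to_field.construct_add[OF indep_words] to_field.construct_scale[OF indep_words])
qed

lemma gr_form_eqI:
  assumes "linear_form f" "linear_form g" "x \<in> gr n"
    and "\<And>w. w \<in> lists B \<Longrightarrow> wdeg w = n \<Longrightarrow> f (wd w) = g (wd w)"
  shows "f x = g x"
proof (rule linear_form_eq_on_span[OF assms(1,2)])
  show "x \<in> span (wd ` deg_words ldeg B n)" using assms(3) unfolding gr_words[of n] .
  fix e assume "e \<in> wd ` deg_words ldeg B n"
  then obtain w where w: "w \<in> lists B" "wdeg w = n" "e = wd w" by (auto simp: deg_words_def)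
  show "f e = g e" unfolding w(3) by (rule assms(4)[OF w(1,2)])
qed

text \<open>The definition cuts a word after its first letter; coassociativity moves the cut to any
  place. The first letter \<open>b\<close> is split off, the identity in lower degrees splits the
  rest into \<open>w\<close> and \<open>v\<close>, and after reassociation \<open>b\<close> is
  rejoined to \<open>w\<close>.\<close>

lemma rform_mult:
  assumes P: "partial_pairing n P" and x: "x \<in> gr n"
    and "1 \<le> i" "1 \<le> j" "y \<in> gr i" "z \<in> gr j"
  shows "rform P x (mult y z) = cosum (\<lambda>a b. P a y * P b z) x"
proof -
  note bP = partial_pairingD(1)[OF P] and hP = partial_pairingD(2)[OF P]
  note PP = bilin_pair[OF bP bP] and rm = right_multiplicativeD[OF partial_pairingD(5)[OF P]]
  have lin1: "linear_form (\<lambda>y. rform P x (mult y z))" "linear_form (\<lambda>z. rform P x (mult y z))" for y z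
    by (rule linear_form_mult[OF bilin_linear(2)[OF bilin_rform[OF bP]]])+
  have lin2: "linear_form (\<lambda>y. cosum (\<lambda>a b. P a y * P b z) x)"
    "linear_form (\<lambda>z. cosum (\<lambda>a b. P a y * P b z) x)" for y z
    by (rule linear_form_cosum_param[OF bP])+
  have lin3: "linear_form (cosum (\<lambda>a b. P a y * P b z))" for y z
    by (rule linear_form_cosum[OF PP])
  show ?thesis
  proof (rule gr_form_eqI[OF lin1(1) lin2(1) \<open>y \<in> gr i\<close>], rule gr_form_eqI[OF lin1(2) lin2(2) \<open>z \<in> gr j\<close>])
    fix u v assume u: "u \<in> lists B" "wdeg u = i" and v: "v \<in> lists B" "wdeg v = j"
    from u \<open>1 \<le> i\<close> obtain b w where w: "u = b # w" "b \<in> B" "w \<in> lists B" by (cases u) auto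
    have vj: "wd v \<in> gr j" using word_homogeneous v by blast
    show "rform P x (mult (wd u) (wd v)) = cosum (\<lambda>a b. P a (wd u) * P b (wd v)) x"
    proof (cases "w = []")
      case True
      then show ?thesis
        using rform_word[OF w(2) v(1), of P x] w by (simp add: word_Cons mult_one_right)
    next
      case False
      have "rform P x (mult (wd u) (wd v)) = rform P x (wd (b # (w @ v)))"
        by (simp only: w word_append[symmetric]) simp
      also have "\<dots> = cosum (\<lambda>p q. P p b * P q (mult (wd w) (wd v))) x"
        using rform_word[OF w(2), of "w @ v" P x] w v by (simp add: word_append)
      also have "\<dots> = cosum (\<lambda>p q. P p b * cosum (\<lambda>c d. P c (wd w) * P d (wd v)) q) x"
      proof (rule cosum_homogeneous_cong[OF x PP bilin_tensor[OF bilin_linear(1)[OF bP] lin3]])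
        fix k l p q assume kl: "k + l = n" "p \<in> gr k" "q \<in> gr l"
        show "P p b * P q (mult (wd w) (wd v)) = P p b * cosum (\<lambda>c d. P c (wd w) * P d (wd v)) q"
        proof (cases "l < n")
          case True
          then show ?thesis using rm[OF _ kl(3)] by simp
        next
          case False
          then have "k = 0" using kl by simp
          then have "P p b = 0"
            using homogeneous_formD[OF hP _ kl(2) letter_deg(1)[OF w(2)]] letter_deg(2)[OF w(2)] by simp
          then show ?thesis by simp
        qed
      qed
      also have "\<dots> = cosum (\<lambda>p q. cosum (\<lambda>c d. P c b * P d (wd w)) p * P q (wd v)) x"
        by (rule cosum_coassoc[symmetric]; rule bilin_linear(1)[OF bP])
      also have "\<dots> = cosum (\<lambda>p q. P p (wd u) * P q (wd v)) x"
      proof (rule cosum_homogeneous_cong[OF x bilin_tensor[OF lin3 bilin_linear(1)[OF bP]] PP])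
        fix k l p q assume kl: "k + l = n" "p \<in> gr k" "q \<in> gr l"
        show "cosum (\<lambda>c d. P c b * P d (wd w)) p * P q (wd v) = P p (wd u) * P q (wd v)"
        proof (cases "k < n")
          case True
          then show ?thesis using rm[OF _ kl(2), of b "wd w"] by (simp add: w word_Cons)
        next
          case False
          then have "l = 0" using kl by simp
          then have "P q (wd v) = 0"
            using homogeneous_formD[OF hP _ kl(3) vj] \<open>1 \<le> j\<close> by simp
          then show ?thesis by simp
        qed
      qed
      finally show ?thesis .
    qed
  qed
qed

text \<open>Written with basis words, so that linear forms can be compared and dimensions counted;
  \<open>aug_ideal_sq_gr\<close> identifies it with the degree \<open>n\<close> part of the square
  of the augmentation ideal.\<close>

definition decomposables :: "nat \<Rightarrow> 'b set" where
  "decomposables n = span (wd ` long_words ldeg B n)"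

lemma decomposables_subset: "decomposables n \<subseteq> gr n"
  unfolding decomposables_def gr_words[of n] by (rule span_mono) (auto simp: long_words_def)

lemma long_word_mult:
  assumes "w \<in> long_words ldeg B n"
  obtains b v i j where "wd w = mult b (wd v)" "1 \<le> i" "1 \<le> j" "i + j = n" "b \<in> gr i" "wd v \<in> gr j"
proof -
  from assms obtain b c u where w: "w = b # c # u" "b \<in> B" "c \<in> B" "u \<in> lists B"
    by (cases w; cases "tl w") (auto simp: long_words_def deg_words_def)
  show ?thesis
  proof (rule that[of b "c # u" "ldeg b" "wdeg (c # u)"])
    show "wd (c # u) \<in> gr (wdeg (c # u))" by (rule word_homogeneous) (use w in simp)
    show "1 \<le> wdeg (c # u)" using letter_deg(2)[OF w(3)] by simp
    show "ldeg b + wdeg (c # u) = n" using assms w by (simp add: long_words_def deg_words_def)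
  qed (use w letter_deg word_Cons in auto)
qed

lemma decomposables_form_eqI:
  assumes "linear_form f" "linear_form g" "x \<in> decomposables n"
    and "\<And>i j y z. 1 \<le> i \<Longrightarrow> 1 \<le> j \<Longrightarrow> i + j = n \<Longrightarrow> y \<in> gr i \<Longrightarrow> z \<in> gr j \<Longrightarrow> f (mult y z) = g (mult y z)"
  shows "f x = g x"
  using assms(3) unfolding decomposables_def
proof (rule linear_form_eq_on_span[OF assms(1,2), rotated])
  fix x assume "x \<in> wd ` long_words ldeg B n"
  then obtain w where w: "w \<in> long_words ldeg B n" "x = wd w" by blast
  from w(1) show "f x = g x"
    unfolding w(2) by (rule long_word_mult) (simp only: assms(4))
qed

lemma decomposables_mult:
  assumes "1 \<le> i" "1 \<le> j" "y \<in> gr i" "z \<in> gr j"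
  shows "mult y z \<in> decomposables (i + j)"
proof -
  have 1: "mult (wd u) (wd v) \<in> decomposables (i + j)"
    if "u \<in> deg_words ldeg B i" "v \<in> deg_words ldeg B j" for u v
  proof -
    have "u \<noteq> []" "v \<noteq> []" using that assms by (auto simp: deg_words_def)
    then have "2 \<le> length (u @ v)" by (cases u; cases v) auto
    then have "u @ v \<in> long_words ldeg B (i + j)"
      using that by (auto simp: long_words_def deg_words_def)
    then show ?thesis
      unfolding decomposables_def word_append[symmetric] by (intro span_base imageI)
  qed
  have sub: "subspace (decomposables (i + j))" unfolding decomposables_def by simp
  have 2: "mult (wd u) z \<in> decomposables (i + j)" if "u \<in> deg_words ldeg B i" for u
  proof -
    have "subspace {z. mult (wd u) z \<in> decomposables (i + j)}"
      using sub mult_sc_right[of _ 0] unfolding subspace_def by (simp add: mult_add_right mult_sc_right)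
    from span_minimal[OF _ this, of "wd ` deg_words ldeg B j"] 1[OF that]
    show ?thesis using assms(4) unfolding gr_words[of j] by blast
  qed
  have "subspace {y. mult y z \<in> decomposables (i + j)}"
    using sub mult_sc_left[of 0] unfolding subspace_def by (simp add: mult_add_left mult_sc_left)
  from span_minimal[OF _ this, of "wd ` deg_words ldeg B i"] 2
  show ?thesis using assms(3) unfolding gr_words[of i] by blast
qed

text \<open>Compatibility of the two prescriptions on products. For products \<open>mult y z\<close>
  and \<open>mult u v\<close>, multiplicativity of the coproduct and the identities in lower degrees
  turn either side into the same fourfold sum over the coproducts of \<open>y\<close>,
  \<open>z\<close>, \<open>u\<close> and \<open>v\<close>.\<close>

lemma rform_flip:
  assumes P: "partial_pairing n P" and "x \<in> decomposables n" "y \<in> decomposables n"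
  shows "rform (flip P) y x = rform P x y"
proof -
  note bP = partial_pairingD(1)[OF P]
  have bF: "bilin (flip P)" using bP by simp
  note lin = bilin_linear[OF bilin_rform[OF bP]] bilin_linear[OF bilin_rform[OF bF]]
  note PP = bilin_pair[OF bP bP] bilin_pair[OF bF bF]
  show ?thesis
  proof (rule decomposables_form_eqI[OF lin(4,1) assms(2)], rule decomposables_form_eqI[OF lin(3,2) assms(3)])
    fix i j y z k l u v
    assume ij: "1 \<le> i" "1 \<le> j" "i + j = n" "y \<in> gr i" "z \<in> gr j"
      and kl: "1 \<le> k" "1 \<le> l" "k + l = n" "u \<in> gr k" "v \<in> gr l"
    have yz: "mult y z \<in> gr n" and uv: "mult u v \<in> gr n" 
      using mult_homog[OF ij(4,5)] mult_homog[OF kl(4,5)] ij(3) kl(3) by simp_all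
    have less: "i < n" "j < n" "k < n" "l < n" using ij kl by auto
    have "rform (flip P) (mult u v) (mult y z) = cosum (\<lambda>a b. flip P a y * flip P b z) (mult u v)"
      by (rule rform_mult[OF partial_pairing_flip[OF P] uv ij(1,2,4,5)])
    also have "\<dots> = cosum (\<lambda>a b. cosum (\<lambda>c d. P y (mult a c) * P z (mult b d)) v) u"
      by (subst cosum_mult[OF PP(2)]) (simp add: flip_def)
    also have "\<dots> = cosum (\<lambda>a b. cosum (\<lambda>c d. cosum (\<lambda>p q. cosum (\<lambda>r s.
        P p a * P q c * (P r b * P s d)) z) y) v) u"
      by (simp only: right_multiplicativeD[OF partial_pairingD(5)[OF P] less(1) ij(4)]
          right_multiplicativeD[OF partial_pairingD(5)[OF P] less(2) ij(5)]
          cosum_scale cosum_scale_right)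
    also have "\<dots> = cosum (\<lambda>p q. cosum (\<lambda>r s. cosum (\<lambda>a b. cosum (\<lambda>c d.
        P p a * P q c * (P r b * P s d)) v) u) z) y"
    proof -
      let ?G = "\<lambda>a b c d p q r s. P p a * P q c * (P r b * P s d)"
      have "cosum (\<lambda>a b. cosum (\<lambda>c d. cosum (\<lambda>p q. cosum (\<lambda>r s. ?G a b c d p q r s) z) y) v) u
          = cosum (\<lambda>a b. cosum (\<lambda>p q. cosum (\<lambda>c d. cosum (\<lambda>r s. ?G a b c d p q r s) z) v) y) u"
        by (rule cosum_cong, rule cosum_swap)
      also have "\<dots> = cosum (\<lambda>p q. cosum (\<lambda>a b. cosum (\<lambda>c d. cosum (\<lambda>r s. ?G a b c d p q r s) z) v) u) y"
        by (rule cosum_swap)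
      also have "\<dots> = cosum (\<lambda>p q. cosum (\<lambda>a b. cosum (\<lambda>r s. cosum (\<lambda>c d. ?G a b c d p q r s) v) z) u) y"
        by (rule cosum_cong, rule cosum_cong, rule cosum_swap)
      also have "\<dots> = cosum (\<lambda>p q. cosum (\<lambda>r s. cosum (\<lambda>a b. cosum (\<lambda>c d. ?G a b c d p q r s) v) u) z) y"
        by (rule cosum_cong, rule cosum_swap)
      finally show ?thesis .
    qed
    \<comment> \<open>Regrouping: \<open>P p a * P r b\<close> summed over the coproduct of
      \<open>u\<close> is the pairing of \<open>mult p r\<close> with \<open>u\<close>, and
      similarly for \<open>q\<close>, \<open>s\<close> and \<open>v\<close>.\<close>
    also have "\<dots> = cosum (\<lambda>p q. cosum (\<lambda>r s. cosum (\<lambda>a b. cosum (\<lambda>c d.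
        P p a * P r b * (P q c * P s d)) v) u) z) y"
      by (rule cosum_cong)+ (simp only: mult_ac)
    also have "\<dots> = cosum (\<lambda>p q. cosum (\<lambda>r s. flip P u (mult p r) * flip P v (mult q s)) z) y"
      by (simp only: right_multiplicativeD[OF partial_pairingD(6)[OF P] less(3) kl(4)]
          right_multiplicativeD[OF partial_pairingD(6)[OF P] less(4) kl(5)]
          cosum_scale cosum_scale_right) (simp only: flip_def)
    also have "\<dots> = cosum (\<lambda>a b. P a u * P b v) (mult y z)"
      by (subst cosum_mult[OF PP(1)]) (simp add: flip_def)
    also have "\<dots> = rform P (mult y z) (mult u v)"
      by (rule rform_mult[OF P yz kl(1,2,4,5), symmetric])
    finally show "rform (flip P) (mult u v) (mult y z) = rform P (mult y z) (mult u v)" .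
  qed
qed

end

section \<open>Primitive elements of a free and cofree Hopf algebra\<close>

context graded_connected_hopf_algebra
begin

abbreviation "primitives \<equiv> prim sc one cop"

lemma prim_iff: "x \<in> primitives \<longleftrightarrow> (\<forall>f. bilin f \<longrightarrow> cosum f x = f x one + f one x)"
  by (simp add: prim_def tensor_eq_def cosum_def)

lemma subspace_prim: "subspace primitives"
  unfolding subspace_def
proof (intro conjI ballI allI)
  show "0 \<in> primitives"
    unfolding prim_iff using linear_formD(3)[OF linear_form_cosum] by (auto simp: bilinD)
  show "x + y \<in> primitives" if "x \<in> primitives" "y \<in> primitives" for x y
    using that unfolding prim_iff
    by (auto simp: linear_formD(1)[OF linear_form_cosum] bilinD(1,2))
  show "sc c x \<in> primitives" if "x \<in> primitives" for c x
    using that unfolding prim_iff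
    by (auto simp: linear_formD(2)[OF linear_form_cosum] bilinD(3,4) distrib_left)
qed

lemma cou_prim:
  assumes "x \<in> primitives"
  shows "cou x = 0"
proof -
  have "cou x = cosum (\<lambda>a b. cou a * cou b) x"
    by (rule cosum_counit_left[OF linear_form_cou, symmetric])
  also have "\<dots> = cou x + cou x"
    by (simp only: cosum_prim[OF bilin_tensor[OF linear_form_cou linear_form_cou] assms] cou_one) simp
  finally show ?thesis by (simp only: add_cancel_right_right)
qed

definition right_nondegenerate :: "nat \<Rightarrow> ('h \<Rightarrow> 'h \<Rightarrow> 'k) \<Rightarrow> bool" where
  "right_nondegenerate k P \<longleftrightarrow> (\<forall>y\<in>gr k. (\<forall>x\<in>gr k. P x y = 0) \<longrightarrow> y = 0)"

end

lemma list_cases3: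
  obtains "w = []" | c where "w = [c]" | u v where "w = u @ v" "u \<noteq> []" "v \<noteq> []"
proof (cases w)
  case (Cons c v)
  show ?thesis
  proof (cases "v = []")
    case False
    then show ?thesis using that(3)[of "[c]" v] Cons by simp
  qed (use that(2) Cons in simp)
qed (use that(1) in simp)

locale free_cofree_hopf_algebra = free_hopf_algebra +
  fixes C :: "'b set" and cdeg :: "'b \<Rightarrow> nat" and e :: "'b list \<Rightarrow> 'b"
  assumes cdeg: "\<forall>c\<in>C. 1 \<le> cdeg c"
    and inj_e: "inj_on e (lists C)"
    and indep_e: "\<not> module.dependent sc (e ` lists C)"
    and span_e: "module.span sc (e ` lists C) = UNIV"
    and e_homogeneous: "w \<in> lists C \<Longrightarrow> e w \<in> gr (\<Sum>c\<leftarrow>w. cdeg c)"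
    and cop_e: "w \<in> lists C \<Longrightarrow> tensor_eq sc (cop (e w))
            (map (\<lambda>i. (e (take i w), e (drop i w))) [0..<Suc (length w)])"
    and cou_e: "w \<in> lists C \<Longrightarrow> cou (e w) = (if w = [] then 1 else 0)"
begin

abbreviation "codeg w \<equiv> \<Sum>c\<leftarrow>w. cdeg c"

lemma gr_cowords: "gr n = span (e ` deg_words cdeg C n)"
  by (rule gr_eq_span_words[OF inj_e indep_e span_e]) (rule e_homogeneous)

lemma e_Nil: "e [] = one"
proof -
  have "e [] \<in> gr 0" using e_homogeneous[of "[]"] by simp
  then obtain c where c: "e [] = sc c one" unfolding gr0 by blast
  have "cou (e []) = 1" using cou_e[of "[]"] by simp
  then show ?thesis unfolding c cou_sc cou_one by simp
qed

section \<open>Coordinates in the deconcatenation basis\<close>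

definition coord :: "'b list \<Rightarrow> 'b \<Rightarrow> 'a" where
  "coord w x = representation (e ` lists C) x (e w)"

lemma linear_form_coord: "linear_form (coord w)"
  unfolding coord_def
  by (rule linear_formI) (simp_all add: representation_add[OF indep_e] representation_scale[OF indep_e] span_e)

lemma coord_e:
  assumes "w \<in> lists C" "v \<in> lists C"
  shows "coord w (e v) = (if v = w then 1 else 0)"
  using representation_basis[OF indep_e imageI[OF assms(2)]] inj_on_eq_iff[OF inj_e assms(2,1)]
  unfolding coord_def by auto

lemma coord_homogeneous:
  assumes "x \<in> gr n" "w \<in> lists C" "codeg w \<noteq> n"
  shows "coord w x = 0"
proof -
  have "coord w x = 0" if "x \<in> e ` deg_words cdeg C n" for x
  proof -
    from that obtain v where v: "v \<in> lists C" "codeg v = n" "x = e v" by (auto simp: deg_words_def)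
    show ?thesis unfolding v(3) coord_e[OF assms(2) v(1)] using v(2) assms(3) by auto
  qed
  then show ?thesis
    using linear_form_zero_on_span[OF linear_form_coord _ assms(1)[unfolded gr_cowords[of n]]] by blast
qed

lemma coord_span:
  assumes "\<And>w. w \<in> lists C \<Longrightarrow> coord w x \<noteq> 0 \<Longrightarrow> e w \<in> A"
  shows "x \<in> span A"
proof -
  let ?r = "representation (e ` lists C) x"
  have "x = (\<Sum>z | ?r z \<noteq> 0. sc (?r z) z)"
    by (rule sum_nonzero_representation_eq[OF indep_e, symmetric]) (simp add: span_e)
  also have "\<dots> \<in> span A"
  proof (intro span_sum span_scale span_base)
    fix z assume z: "z \<in> {z. ?r z \<noteq> 0}"
    then have "z \<in> e ` lists C" using representation_ne_zero by blast
    then obtain w where w: "w \<in> lists C" "z = e w" by blast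
    with z have "coord w x \<noteq> 0" by (simp add: coord_def)
    from assms[OF w(1) this] show "z \<in> A" unfolding w(2) .
  qed
  finally show ?thesis .
qed

text \<open>Deconcatenation is dual to concatenation. On a basis word \<open>w\<close> only the cut
  at position \<open>length u\<close> can contribute, and it does so exactly if
  \<open>w = u @ v\<close>.\<close>

lemma coord_append:
  assumes u: "u \<in> lists C" and v: "v \<in> lists C"
  shows "coord (u @ v) x = cosum (\<lambda>a b. coord u a * coord v b) x"
proof (rule linear_form_eq_on_span[OF linear_form_coord linear_form_cosum])
  show bil: "bilin (\<lambda>a b. coord u a * coord v b)"
    by (rule bilin_tensor[OF linear_form_coord linear_form_coord])
  show "x \<in> span (e ` lists C)" by (simp add: span_e)
  fix z assume "z \<in> e ` lists C"
  then obtain w where w: "w \<in> lists C" "z = e w" by blast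
  have td: "take i w \<in> lists C" "drop i w \<in> lists C" for i
    using w(1) in_set_takeD in_set_dropD by fastforce+
  have uv: "u @ v \<in> lists C" using u v by simp
  have "cosum (\<lambda>a b. coord u a * coord v b) z
      = (\<Sum>i\<leftarrow>[0..<Suc (length w)]. coord u (e (take i w)) * coord v (e (drop i w)))"
    unfolding w(2) cosum_tensor_eq[OF bil cop_e[OF w(1)]] by (simp only: map_map o_def prod.case)
  also have "\<dots> = (\<Sum>i\<in>{0..<Suc (length w)}. if take i w = u \<and> drop i w = v then 1 else 0)"
    unfolding interv_sum_list_conv_sum_set_nat set_upt
    by (rule sum.cong) (simp_all add: coord_e[OF u td(1)] coord_e[OF v td(2)])
  also have "\<dots> = (if w = u @ v then 1 else 0)"
  proof (cases "w = u @ v")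
    case True
    have "(\<Sum>i\<in>{0..<Suc (length w)}. if take i w = u \<and> drop i w = v then 1 else 0)
        = (\<Sum>i\<in>{0..<Suc (length w)}. if i = length u then 1 else (0::'a))"
    proof (rule sum.cong)
      fix i assume "i \<in> {0..<Suc (length w)}"
      then have "i = length u" if "take i w = u"
        using arg_cong[OF that, of length] by simp
      then have "take i w = u \<and> drop i w = v \<longleftrightarrow> i = length u" using True by auto
      then show "(if take i w = u \<and> drop i w = v then 1 else 0) = (if i = length u then 1 else (0::'a))"
        by simp
    qed simp
    also have "\<dots> = 1" using True by (subst sum.delta) auto
    finally show ?thesis using True by simp
  next
    case False
    then have "(take i w = u \<and> drop i w = v) = False" for i by (metis append_take_drop_id)
    then show ?thesis using False by (simp only: if_False sum.neutral_const)
  qed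
  also have "\<dots> = coord (u @ v) z" unfolding w(2) coord_e[OF uv w(1)] ..
  finally show "coord (u @ v) z = cosum (\<lambda>a b. coord u a * coord v b) z" ..
qed

abbreviation "coletters \<equiv> (\<lambda>c. e [c]) ` C"

text \<open>For primitive \<open>x\<close> each surviving term of the convolution evaluates one of
  the two coordinates at \<open>one\<close>, the empty word, where it is 0.\<close>

lemma coord_prim:
  assumes x: "x \<in> primitives" and u: "u \<in> lists C" "u \<noteq> []" and v: "v \<in> lists C" "v \<noteq> []"
  shows "coord (u @ v) x = 0"
proof -
  have "coord u one = 0" "coord v one = 0"
    using coord_e[OF u(1), of "[]"] coord_e[OF v(1), of "[]"] u v by (simp_all add: e_Nil)
  then show ?thesis
    unfolding coord_append[OF u(1) v(1)] cosum_prim[OF bilin_tensor[OF linear_form_coord linear_form_coord] x]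
    by simp
qed

text \<open>A primitive element has no coordinate at long words by \<open>coord_prim\<close>. Its
  coordinate at the empty word equals twice itself, since the empty word is idempotent for
  concatenation, and so is 0.\<close>

lemma prim_eq_span: "primitives = span coletters"
proof
  show "span coletters \<subseteq> primitives"
  proof (rule span_minimal[OF _ subspace_prim], rule image_subsetI)
    fix c assume "c \<in> C"
    then have "tensor_eq sc (cop (e [c])) (map (\<lambda>i. (e (take i [c]), e (drop i [c]))) [0..<Suc (length [c])])"
      by (intro cop_e) simp
    then show "e [c] \<in> primitives"
      by (simp add: prim_def tensor_eq_def e_Nil add.commute)
  qed
  show "primitives \<subseteq> span coletters"
  proof
    fix x assume x: "x \<in> primitives"
    show "x \<in> span coletters"
    proof (rule coord_span)
      fix w assume w: "w \<in> lists C" "coord w x \<noteq> 0"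
      show "e w \<in> coletters"
      proof (cases w rule: list_cases3)
        case 1
        have "coord [] x = cosum (\<lambda>a b. coord [] a * coord [] b) x"
          using coord_append[of "[]" "[]" x] by simp
        also have "\<dots> = coord [] x + coord [] x"
          using coord_e[of "[]" "[]"]
          by (simp add: cosum_prim[OF bilin_tensor[OF linear_form_coord linear_form_coord] x] e_Nil)
        finally have "coord w x = 0" unfolding 1 by (simp only: add_cancel_right_right)
        with w(2) show ?thesis ..
      next
        case 2
        then show ?thesis using w(1) by auto
      next
        case 3
        then show ?thesis using coord_prim[OF x, of u v for u v] w by auto
      qed
    qed
  qed
qed

lemma coletter_prim: "c \<in> C \<Longrightarrow> e [c] \<in> primitives" "c \<in> C \<Longrightarrow> e [c] \<in> gr (cdeg c)"
  unfolding prim_eq_span using e_homogeneous[of "[c]"] by (auto intro: span_base)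

text \<open>On the basis words of degree \<open>k\<close> the form has a square matrix, which has
  trivial kernel and is therefore surjective.\<close>

lemma form_representable:
  assumes P: "bilin P" "right_nondegenerate k P" and f: "linear_form f"
  obtains y where "y \<in> gr k" "\<And>a. a \<in> gr k \<Longrightarrow> P a y = f a"
proof -
  let ?W = "wd ` deg_words ldeg B k"
  have fin: "finite ?W"
    by (intro finite_imageI finite_deg_words[OF inj_word indep_words span_words] word_homogeneous)
  have ind: "independent ?W"
    by (rule independent_mono[OF indep_words]) (auto simp: deg_words_def)
  have W: "c \<in> gr k" if "c \<in> ?W" for c
    unfolding gr_words[of k] using that by (rule span_base)
  have comb: "(\<Sum>c\<in>?W. sc (l c) c) \<in> gr k" for l
    using W by (intro subspace_sum[OF gr_subspace] subspace_scale[OF gr_subspace])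
  have Pcomb: "P a (\<Sum>c\<in>?W. sc (l c) c) = (\<Sum>c\<in>?W. P a c * l c)" for a l
    by (simp only: linear_formD(5)[OF bilin_linear(2)[OF P(1)]] bilinD(4)[OF P(1)] mult.commute)
  have "\<exists>l. \<forall>a\<in>?W. (\<Sum>c\<in>?W. P a c * l c) = f a"
  proof (rule trivial_kernel_surj[OF fin fin order_refl])
    fix l assume l: "\<And>a. a \<in> ?W \<Longrightarrow> (\<Sum>c\<in>?W. P a c * l c) = 0"
    have "P a (\<Sum>c\<in>?W. sc (l c) c) = 0" if "a \<in> gr k" for a
      using linear_form_zero_on_span[OF bilin_linear(1)[OF P(1)] _ that[unfolded gr_words[of k]],
          of "\<Sum>c\<in>?W. sc (l c) c"] l unfolding Pcomb by blast
    then have "(\<Sum>c\<in>?W. sc (l c) c) = 0"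
      using P(2) comb unfolding right_nondegenerate_def by blast
    then show "\<forall>c\<in>?W. l c = 0"
      using independentD[OF ind fin order_refl] by blast
  qed
  then obtain l where l: "\<And>a. a \<in> ?W \<Longrightarrow> (\<Sum>c\<in>?W. P a c * l c) = f a" by blast
  show ?thesis
  proof (rule that[OF comb[of l]])
    fix a assume "a \<in> gr k"
    then have "a \<in> span ?W" unfolding gr_words[of k] .
    then show "P a (\<Sum>c\<in>?W. sc (l c) c) = f a"
      by (rule linear_form_eq_on_span[OF bilin_linear(1)[OF P(1)] f, rotated]) (simp only: Pcomb l)
  qed
qed

text \<open>For non-empty \<open>u\<close> and \<open>v\<close>, non-degeneracy in lower degrees
  represents the coordinates at \<open>u\<close> and \<open>v\<close> by elements \<open>y\<close>
  and \<open>z\<close>. The coordinate of \<open>x\<close> at \<open>u @ v\<close> is then the value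
  of \<open>rform P x\<close> on the product of \<open>y\<close> and \<open>z\<close>, which is
  decomposable. So only letters remain in the expansion of \<open>x\<close>.\<close>

lemma rform_kernel_prim:
  assumes P: "partial_pairing n P" and nd: "\<forall>k<n. right_nondegenerate k P"
    and n: "1 \<le> n" and x: "x \<in> gr n" and ker: "\<And>s. s \<in> decomposables n \<Longrightarrow> rform P x s = 0"
  shows "x \<in> primitives"
  unfolding prim_eq_span
proof (rule coord_span)
  note bP = partial_pairingD(1)[OF P] and hP = partial_pairingD(2)[OF P]
  fix w assume w: "w \<in> lists C" "coord w x \<noteq> 0"
  show "e w \<in> coletters"
  proof (cases w rule: list_cases3)
    case 1
    then have "coord w x = 0" using coord_homogeneous[OF x w(1)] n by simp
    with w(2) show ?thesis ..
  next
    case 2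
    then show ?thesis using w(1) by auto
  next
    case (3 u v)
    have u: "u \<in> lists C" and v: "v \<in> lists C" using w(1) 3 by auto
    define i j where "i = codeg u" and "j = codeg v"
    have ij: "i + j = n"
      using coord_homogeneous[OF x w(1)] w(2) 3 by (auto simp: i_def j_def)
    have "1 \<le> i" "1 \<le> j"
      using 3 u v cdeg unfolding i_def j_def by (cases u; cases v; fastforce)+
    then have less: "i < n" "j < n" using ij by auto
    obtain y where y: "y \<in> gr i" "\<And>a. a \<in> gr i \<Longrightarrow> P a y = coord u a"
      using form_representable[OF bP nd[rule_format, OF less(1)] linear_form_coord[of u]] by blast
    obtain z where z: "z \<in> gr j" "\<And>a. a \<in> gr j \<Longrightarrow> P a z = coord v a"
      using form_representable[OF bP nd[rule_format, OF less(2)] linear_form_coord[of v]] by blast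
    have "coord w x = cosum (\<lambda>a b. coord u a * coord v b) x"
      unfolding 3(1) by (rule coord_append[OF u v])
    also have "\<dots> = cosum (\<lambda>a b. P a y * P b z) x"
    proof (rule cosum_homogeneous_cong[OF x bilin_tensor[OF linear_form_coord linear_form_coord] bilin_pair[OF bP bP]])
      fix p q a b assume pq: "p + q = n" "a \<in> gr p" "b \<in> gr q"
      show "coord u a * coord v b = P a y * P b z"
      proof (cases "p = i")
        case True
        then have "q = j" using pq ij by simp
        then show ?thesis using y(2)[of a] z(2)[of b] pq True by simp
      next
        case False
        then have "coord u a = 0" "P a y = 0"
          using coord_homogeneous[OF pq(2) u] homogeneous_formD[OF hP _ pq(2) y(1)] by (auto simp: i_def)
        then show ?thesis by simp
      qed
    qed
    also have "\<dots> = rform P x (mult y z)"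
      by (rule rform_mult[OF P x \<open>1 \<le> i\<close> \<open>1 \<le> j\<close> y(1) z(1), symmetric])
    also have "\<dots> = 0"
      by (rule ker) (use decomposables_mult[OF \<open>1 \<le> i\<close> \<open>1 \<le> j\<close> y(1) z(1)] ij in simp)
    finally show ?thesis using w(2) by simp
  qed
qed

text \<open>Both families of words of degree \<open>m\<close> are bases of the same component. The
  equality makes the matrix in \<open>rform_left_kernel\<close> square.\<close>

lemma card_long_words_free_cofree: "card (long_words ldeg B n) = card (long_words cdeg C n)"
proof (rule card_long_words_cong)
  have fin: "finite (deg_words ldeg B m)" "finite (deg_words cdeg C m)" for m
    using finite_deg_words[OF inj_word indep_words span_words word_homogeneous]
      finite_deg_words[OF inj_e indep_e span_e e_homogeneous] by blast+
  then show "\<forall>m. finite (deg_words ldeg B m)" "\<forall>m. finite (deg_words cdeg C m)" by blast+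
  show "\<forall>b\<in>B. 1 \<le> ldeg b" using letter_deg(2) by blast
  show "\<forall>c\<in>C. 1 \<le> cdeg c" by (rule cdeg)
  fix m
  have sub: "deg_words ldeg B m \<subseteq> lists B" "deg_words cdeg C m \<subseteq> lists C"
    by (auto simp: deg_words_def)
  note ind = independent_mono[OF indep_words image_mono[OF sub(1)]]
    independent_mono[OF indep_e image_mono[OF sub(2)]]
  have "wd ` deg_words ldeg B m \<subseteq> span (e ` deg_words cdeg C m)"
    unfolding gr_cowords[of m, symmetric] gr_words[of m] by (rule span_superset)
  moreover have "e ` deg_words cdeg C m \<subseteq> span (wd ` deg_words ldeg B m)"
    unfolding gr_words[of m, symmetric] gr_cowords[of m] by (rule span_superset)
  ultimately have "card (wd ` deg_words ldeg B m) = card (e ` deg_words cdeg C m)"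
    using independent_span_bound[OF finite_imageI[OF fin(2)] ind(1)]
      independent_span_bound[OF finite_imageI[OF fin(1)] ind(2)] by (meson order_antisym)
  then show "card (deg_words ldeg B m) = card (deg_words cdeg C m)"
    unfolding card_image[OF inj_on_subset[OF inj_word sub(1)]] card_image[OF inj_on_subset[OF inj_e sub(2)]] .
qed

text \<open>Consider the matrix of \<open>rform P\<close> with the deconcatenation basis at long
  words on the left and long words in the free generators on the right. A combination of the former
  orthogonal to all the latter is primitive by \<open>rform_kernel_prim\<close>, and a primitive
  element has no coordinate at long words, so it is 0. As the matrix is square, the kernel on the
  other side is trivial too.\<close>

lemma rform_left_kernel:
  assumes P: "partial_pairing n P" and nd: "\<forall>k<n. right_nondegenerate k P"
    and n: "1 \<le> n" and s: "s \<in> decomposables n" and ker: "\<And>x. x \<in> gr n \<Longrightarrow> rform P x s = 0"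
  shows "s = 0"
proof -
  let ?A = "long_words ldeg B n" and ?C = "long_words cdeg C n"
  note bR = bilin_rform[OF partial_pairingD(1)[OF P]]
  have subA: "?A \<subseteq> lists B" and subC: "?C \<subseteq> lists C"
    by (auto simp: long_words_def deg_words_def)
  have fin: "finite ?A" "finite ?C"
    using finite_deg_words[OF inj_word indep_words span_words word_homogeneous]
      finite_deg_words[OF inj_e indep_e span_e e_homogeneous]
    by (auto simp: long_words_def)
  have eC: "e c \<in> gr n" if "c \<in> ?C" for c
    using that e_homogeneous by (auto simp: long_words_def deg_words_def)
  from s have "s \<in> range (\<lambda>u. \<Sum>v\<in>wd ` ?A. sc (u v) v)"
    unfolding decomposables_def span_finite[OF finite_imageI[OF fin(1)]] .
  then obtain u where "s = (\<Sum>v\<in>wd ` ?A. sc (u v) v)" by blast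
  then have s_eq: "s = (\<Sum>a\<in>?A. sc (u (wd a)) (wd a))"
    by (simp add: sum.reindex[OF inj_on_subset[OF inj_word subA]])
  have "u (wd a) = 0" if "a \<in> ?A" for a
  proof (rule trivial_kernel_transpose[OF fin, where M = "\<lambda>a c. rform P (e c) (wd a)"
        and m = "\<lambda>a. u (wd a)"])
    show "card ?A \<le> card ?C" by (simp add: card_long_words_free_cofree)
    show "(\<Sum>a\<in>?A. u (wd a) * rform P (e c) (wd a)) = 0" if "c \<in> ?C" for c
      using ker[OF eC[OF that]] unfolding s_eq
      by (simp only: linear_formD(5)[OF bilin_linear(2)[OF bR]] bilinD(4)[OF bR])
  next
    fix l assume l: "\<And>a. a \<in> ?A \<Longrightarrow> (\<Sum>c\<in>?C. rform P (e c) (wd a) * l c) = 0"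
    define x where "x = (\<Sum>c\<in>?C. sc (l c) (e c))"
    have "x \<in> gr n"
      unfolding x_def using eC by (intro subspace_sum[OF gr_subspace] subspace_scale[OF gr_subspace])
    moreover have "rform P x (wd a) = 0" if "a \<in> ?A" for a
      unfolding x_def using l[OF that]
      by (simp only: linear_formD(5)[OF bilin_linear(1)[OF bR]] bilinD(3)[OF bR] mult.commute)
    then have "rform P x t = 0" if "t \<in> decomposables n" for t
      using linear_form_zero_on_span[OF bilin_linear(2)[OF bR] _ that[unfolded decomposables_def], of x]
      by blast
    ultimately have "x \<in> primitives" using rform_kernel_prim[OF P nd n] by blast
    show "\<forall>c\<in>?C. l c = 0"
    proof
      fix c assume c: "c \<in> ?C"
      then obtain p q where pq: "c = p @ q" "p \<noteq> []" "q \<noteq> []"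
        by (cases c rule: list_cases3) (auto simp: long_words_def)
      have cC: "c \<in> lists C" using c subC by blast
      then have "0 = coord c x"
        using coord_prim[OF \<open>x \<in> primitives\<close> _ pq(2) _ pq(3)] pq(1) by simp
      also have "\<dots> = (\<Sum>d\<in>?C. l d * coord c (e d))"
        unfolding x_def by (simp only: linear_formD(2,5)[OF linear_form_coord])
      also have "\<dots> = (\<Sum>d\<in>?C. if d = c then l d else 0)"
      proof (rule sum.cong)
        fix d assume "d \<in> ?C"
        then have "d \<in> lists C" using subC by blast
        then show "l d * coord c (e d) = (if d = c then l d else 0)" by (simp only: coord_e[OF cC]) simp
      qed simp
      also have "\<dots> = l c" using fin c by simp
      finally show "l c = 0" ..
    qed
  qed (rule that)
  then show "s = 0" unfolding s_eq by simp
qed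

text \<open>A generator of the square may be a product of inhomogeneous elements. Hence the elements
  whose component of degree \<open>n\<close> is decomposable are shown to form a subspace containing
  all these products, starting from homogeneous factors.\<close>

lemma aug_ideal_sq_gr: "aug_ideal_sq sc gr mult \<inter> gr n = decomposables n"
proof (intro equalityI subsetI)
  fix x assume x: "x \<in> decomposables n"
  have gr_aug: "gr i \<subseteq> aug_ideal sc gr" if "1 \<le> i" for i
    unfolding aug_ideal_def using that by (intro subset_trans[OF _ span_superset]) auto
  have "wd ` long_words ldeg B n \<subseteq> {mult x y | x y. x \<in> aug_ideal sc gr \<and> y \<in> aug_ideal sc gr}"
  proof (rule image_subsetI)
    fix w assume "w \<in> long_words ldeg B n"
    then obtain b v i j where "wd w = mult b (wd v)" "1 \<le> i" "1 \<le> j" "i + j = n" "b \<in> gr i" "wd v \<in> gr j"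
      by (rule long_word_mult)
    then show "wd w \<in> {mult x y | x y. x \<in> aug_ideal sc gr \<and> y \<in> aug_ideal sc gr}"
      using gr_aug by blast
  qed
  from span_mono[OF this] x have "x \<in> aug_ideal_sq sc gr mult"
    unfolding aug_ideal_sq_def decomposables_def by blast
  then show "x \<in> aug_ideal_sq sc gr mult \<inter> gr n" using x decomposables_subset by blast
next
  fix x assume x: "x \<in> aug_ideal_sq sc gr mult \<inter> gr n"
  obtain p where p: "linear_map p" "\<And>x. x \<in> gr n \<Longrightarrow> p x = x"
    "\<And>k x. k \<noteq> n \<Longrightarrow> x \<in> gr k \<Longrightarrow> p x = 0" "\<And>x. p x \<in> gr n"
    by (rule gr_projection[of n]) (rule that)
  let ?T = "{x. p x \<in> decomposables n}"
  have sub: "subspace (decomposables m)" for m unfolding decomposables_def by simp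
  have subT: "subspace ?T"
    using sub[of n] endo.linear_0[OF p(1)] unfolding subspace_def by (simp add: linear_mapD[OF p(1)])
  have 1: "mult y z \<in> ?T" if "1 \<le> i" "1 \<le> j" "y \<in> gr i" "z \<in> gr j" for i j y z
  proof (cases "i + j = n")
    case True
    then have "mult y z \<in> decomposables n" using decomposables_mult[OF that] by simp
    then show ?thesis using p(2)[of "mult y z"] decomposables_subset[of n] by auto
  next
    case False
    then show ?thesis using p(3)[OF _ mult_homog[OF that(3,4)]] subspace_0[OF sub] by simp
  qed
  have 2: "mult y z \<in> ?T" if "1 \<le> i" "y \<in> gr i" "z \<in> aug_ideal sc gr" for i y z
  proof -
    have "subspace {z. mult y z \<in> ?T}"
      using subT mult_sc_right[of y 0] unfolding subspace_def by (simp add: mult_add_right mult_sc_right)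
    from span_minimal[OF _ this, of "\<Union>n\<in>{1..}. gr n"] 1[OF that(1) _ that(2)]
    show ?thesis using that(3) unfolding aug_ideal_def by blast
  qed
  have 3: "mult y z \<in> ?T" if "y \<in> aug_ideal sc gr" "z \<in> aug_ideal sc gr" for y z
  proof -
    have "subspace {y. mult y z \<in> ?T}"
      using subT mult_sc_left[of 0 _ z] unfolding subspace_def by (simp add: mult_add_left mult_sc_left)
    from span_minimal[OF _ this, of "\<Union>n\<in>{1..}. gr n"] 2[OF _ _ that(2)]
    show ?thesis using that(1) unfolding aug_ideal_def by blast
  qed
  have "aug_ideal_sq sc gr mult \<subseteq> ?T"
    unfolding aug_ideal_sq_def by (rule span_minimal[OF _ subT]) (use 3 in blast)
  then show "x \<in> decomposables n" using x p(2) by auto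
qed

end

section \<open>Extending a pairing by one degree\<close>

locale free_cofree_hopf_algebra_form = free_cofree_hopf_algebra +
  fixes \<beta> :: "'b \<Rightarrow> 'b \<Rightarrow> 'a"
  assumes form: "quotient_form sc (prim sc one cop) (aug_ideal_sq sc gr mult) \<beta>"
    and nondeg: "quotient_form_nondegenerate (prim sc one cop) (aug_ideal_sq sc gr mult) \<beta>"
    and homog: "quotient_form_homogeneous gr (prim sc one cop) \<beta>"
begin

lemma beta:
  assumes "x \<in> primitives" "y \<in> primitives"
  shows "z \<in> primitives \<Longrightarrow> \<beta> (x + y) z = \<beta> x z + \<beta> y z"
    "z \<in> primitives \<Longrightarrow> \<beta> z (x + y) = \<beta> z x + \<beta> z y"
    "\<beta> (sc c x) y = c * \<beta> x y" "\<beta> x (sc c y) = c * \<beta> x y"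
  using form[unfolded quotient_form_def, THEN conjunct1, rule_format, OF assms]
    form[unfolded quotient_form_def, THEN conjunct2, THEN conjunct1, rule_format, OF assms]
  by simp_all

lemma beta_sq:
  assumes "x \<in> primitives" "x \<in> aug_ideal_sq sc gr mult" "y \<in> primitives"
  shows "\<beta> x y = 0" "\<beta> y x = 0"
  using form[unfolded quotient_form_def, THEN conjunct2, THEN conjunct2, rule_format, OF IntI[OF assms(1,2)] assms(3)]
  by simp_all

lemma beta_homogeneous:
  assumes "x \<in> primitives" "x \<in> gr i" "y \<in> primitives" "y \<in> gr j" "i \<noteq> j"
  shows "\<beta> x y = 0"
  by (rule homog[unfolded quotient_form_homogeneous_def, rule_format, OF IntI[OF assms(1,2)] IntI[OF assms(3,4)] assms(5)])

lemma beta_decomposable: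
  assumes "x \<in> primitives" "x \<in> decomposables n" "y \<in> primitives"
  shows "\<beta> x y = 0" "\<beta> y x = 0"
proof -
  have "x \<in> aug_ideal_sq sc gr mult" using assms(2) aug_ideal_sq_gr[of n] by blast
  from beta_sq[OF assms(1) this assms(3)] show "\<beta> x y = 0" "\<beta> y x = 0" .
qed

lemma beta_0:
  assumes "y \<in> primitives"
  shows "\<beta> 0 y = 0" "\<beta> y 0 = 0"
proof -
  have "0 \<in> decomposables 0" unfolding decomposables_def by (rule span_zero)
  from beta_decomposable[OF subspace_0[OF subspace_prim] this assms]
  show "\<beta> 0 y = 0" "\<beta> y 0 = 0" .
qed

text \<open>The assumptions on \<open>\<beta>\<close> treat both arguments alike, so left-hand
  results can be used on the right through \<open>flip \<beta>\<close>.\<close>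

lemma flipped: "free_cofree_hopf_algebra_form sc gr mult one cop cou ant B C cdeg e (flip \<beta>)"
proof unfold_locales
  show "quotient_form sc primitives (aug_ideal_sq sc gr mult) (flip \<beta>)"
    unfolding quotient_form_def flip_def by (simp add: beta beta_sq)
  show "quotient_form_nondegenerate primitives (aug_ideal_sq sc gr mult) (flip \<beta>)"
    using nondeg unfolding quotient_form_nondegenerate_def flip_def by (simp only: simp_thms conj_commute)
  show "quotient_form_homogeneous gr primitives (flip \<beta>)"
    unfolding quotient_form_homogeneous_def flip_def using beta_homogeneous by auto
qed

text \<open>By homogeneity \<open>x\<close> is orthogonal to the cogenerators of every other degree
  as well, hence to all primitive elements, and non-degeneracy on the quotient puts it into the
  square of the augmentation ideal.\<close>

lemma beta_kernel:
  assumes x: "x \<in> primitives" "x \<in> gr n" and ker: "\<And>y. y \<in> primitives \<inter> gr n \<Longrightarrow> \<beta> x y = 0"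
  shows "x \<in> decomposables n"
proof -
  have "subspace {y \<in> primitives. \<beta> x y = 0}"
    unfolding subspace_def using subspace_prim[unfolded subspace_def] x(1)
    by (simp add: beta_0 beta)
  moreover have "coletters \<subseteq> {y \<in> primitives. \<beta> x y = 0}"
  proof (rule image_subsetI)
    fix c assume "c \<in> C"
    note c = coletter_prim[OF this]
    have "\<beta> x (e [c]) = 0"
    proof (cases "cdeg c = n")
      case True
      then show ?thesis using ker c by auto
    next
      case False
      then show ?thesis using beta_homogeneous[OF x c] by simp
    qed
    then show "e [c] \<in> {y \<in> primitives. \<beta> x y = 0}" using c by simp
  qed
  ultimately have "span coletters \<subseteq> {y \<in> primitives. \<beta> x y = 0}"
    by (rule span_minimal[rotated])
  then have "\<forall>y\<in>primitives. \<beta> x y = 0" using prim_eq_span by blast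
  then have "x \<in> aug_ideal_sq sc gr mult"
    by (rule nondeg[unfolded quotient_form_nondegenerate_def, THEN conjunct1, THEN bspec, OF x(1), THEN mp])
  then show ?thesis using x(2) aug_ideal_sq_gr[of n] by blast
qed

text \<open>The coproduct of a primitive element leaves only terms containing the counit of
  \<open>y\<close> or of \<open>z\<close>, both of positive degree. This is why the values on
  primitive elements can be prescribed independently.\<close>

lemma rform_prim:
  assumes P: "partial_pairing n P" and x: "x \<in> primitives" "x \<in> gr n" and s: "s \<in> decomposables n"
  shows "rform P x s = 0"
proof (rule decomposables_form_eqI[OF bilin_linear(2)[OF bilin_rform] _ s])
  note bP = partial_pairingD(1)[OF P]
  show "bilin P" by (rule bP)
  show "linear_form (\<lambda>_. 0)" by (rule linear_formI) simp_all
  fix i j y z assume ij: "1 \<le> i" "1 \<le> j" "y \<in> gr i" "z \<in> gr j"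
  have "rform P x (mult y z) = P x y * P one z + P one y * P x z"
    unfolding rform_mult[OF P x(2) ij] by (rule cosum_prim[OF bilin_pair[OF bP bP] x(1)])
  also have "\<dots> = 0"
    using cou_homog[OF ij(1,3)] cou_homog[OF ij(2,4)] by (simp add: partial_pairingD(3)[OF P])
  finally show "rform P x (mult y z) = 0" .
qed

lemma top_left_kernel:
  assumes P: "partial_pairing n P"
    and nd: "\<forall>k<n. right_nondegenerate k P" "\<forall>k<n. right_nondegenerate k (flip P)"
    and n: "1 \<le> n"
    and Q: "\<And>x s. x \<in> gr n \<Longrightarrow> s \<in> decomposables n \<Longrightarrow> Q x s = rform P x s"
      "\<And>y s. y \<in> gr n \<Longrightarrow> s \<in> decomposables n \<Longrightarrow> Q s y = rform (flip P) y s"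
      "\<And>x y. x \<in> primitives \<inter> gr n \<Longrightarrow> y \<in> primitives \<inter> gr n \<Longrightarrow> Q x y = \<beta> x y"
    and x: "x \<in> gr n" and ker: "\<And>y. y \<in> gr n \<Longrightarrow> Q x y = 0"
  shows "x = 0"
proof -
  have "rform P x s = 0" if "s \<in> decomposables n" for s
    using Q(1)[OF x that] ker[OF subsetD[OF decomposables_subset that]] by simp
  then have prim: "x \<in> primitives" by (rule rform_kernel_prim[OF P nd(1) n x])
  have "\<beta> x y = 0" if "y \<in> primitives \<inter> gr n" for y
    using Q(3)[of x y] that prim x ker by auto
  then have dec: "x \<in> decomposables n" by (rule beta_kernel[OF prim x])
  have "rform (flip P) y x = 0" if "y \<in> gr n" for y
    using Q(2)[OF that dec] ker[OF that] by simp
  then show ?thesis by (rule rform_left_kernel[OF partial_pairing_flip[OF P] nd(2) n dec])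
qed

definition good_pairing :: "nat \<Rightarrow> ('b \<Rightarrow> 'b \<Rightarrow> 'a) \<Rightarrow> bool" where
  "good_pairing n P \<longleftrightarrow> partial_pairing n P
     \<and> (\<forall>k<n. right_nondegenerate k P \<and> right_nondegenerate k (flip P))
     \<and> (\<forall>k<n. \<forall>x\<in>primitives \<inter> gr k. \<forall>y\<in>primitives \<inter> gr k. P x y = \<beta> x y)"

text \<open>\<open>rform (flip P)\<close> settles the component of \<open>x\<close> in S, and
  \<open>rform P\<close> the component of \<open>y\<close> in S against the remainder of
  \<open>x\<close>. They are consistent on S x S by \<open>rform_flip\<close>;
  \<open>rform_prim\<close> and \<open>beta_decomposable\<close> exclude a clash with
  \<open>\<beta>\<close>.\<close>

lemma top_form_exists:
  assumes P: "partial_pairing n P"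
  obtains Q where "bilin Q"
    "\<And>x s. x \<in> gr n \<Longrightarrow> s \<in> decomposables n \<Longrightarrow> Q x s = rform P x s"
    "\<And>y s. y \<in> gr n \<Longrightarrow> s \<in> decomposables n \<Longrightarrow> Q s y = rform (flip P) y s"
    "\<And>x y. x \<in> primitives \<inter> gr n \<Longrightarrow> y \<in> primitives \<inter> gr n \<Longrightarrow> Q x y = \<beta> x y"
    "flip P = P \<Longrightarrow> (\<forall>x\<in>primitives. \<forall>y\<in>primitives. \<beta> x y = \<beta> y x) \<Longrightarrow> flip Q = Q"
proof -
  let ?S = "decomposables n" and ?G = "primitives \<inter> gr n"
  have subS: "subspace ?S" unfolding decomposables_def by simp
  have subG: "subspace ?G" by (rule subspace_inter[OF subspace_prim gr_subspace])
  obtain p q where pq: "linear_map p" "linear_map q" and p_S: "\<And>x. p x \<in> ?S" and q_G: "\<And>x. q x \<in> ?G"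
    and on_S: "\<And>x. x \<in> ?S \<Longrightarrow> p x = x" "\<And>x. x \<in> ?S \<Longrightarrow> q x = 0" and on_G: "\<And>x. x \<in> ?G \<Longrightarrow> p x + q x = x"
    using adapted_projections[OF subS subG] by blast
  have q_prim: "q x \<in> primitives" for x using q_G by blast
  have bF: "bilin (flip P)" using partial_pairingD(1)[OF P] by simp
  note R = bilin_rform[OF partial_pairingD(1)[OF P]] and L = bilin_rform[OF bF]
  \<comment> \<open>\<open>p\<close> and \<open>q\<close> project onto the first two summands of a decomposition \<open>S \<oplus> M \<oplus> W\<close> with
    \<open>M \<subseteq> G \<subseteq> S \<oplus> M\<close>; the form is made zero on \<open>M \<times> W\<close>, \<open>W \<times> M\<close> and \<open>W \<times> W\<close>.\<close>
  define Q where "Q x y = rform (flip P) y (p x) + rform P (x - p x) (p y) + \<beta> (q x) (q y)" for x y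
  have "bilin Q"
    unfolding bilinear_form_def Q_def
    by (simp add: linear_mapD[OF pq(1)] linear_mapD[OF pq(2)] bilinD[OF R] bilinD[OF L]
        beta q_prim distrib_left right_diff_distrib)
  moreover have "Q x s = rform P x s" if "x \<in> gr n" "s \<in> ?S" for x s
    using rform_flip[OF P p_S that(2), of x] beta_0(2)[OF q_prim]
    by (simp add: Q_def on_S[OF that(2)] bilinD[OF R])
  moreover have "Q s y = rform (flip P) y s" if "y \<in> gr n" "s \<in> ?S" for y s
    using beta_0(1)[OF q_prim] by (simp add: Q_def on_S[OF that(2)] bilinD[OF R])
  moreover have "Q x y = \<beta> x y" if x: "x \<in> ?G" and y: "y \<in> ?G" for x y
  proof -
    \<comment> \<open>For \<open>z\<close> in G the vector \<open>p z\<close> is primitive and lies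
      in S, so \<open>\<beta>\<close> ignores it and only \<open>q z\<close> counts.\<close>
    have p: "p z \<in> primitives" "z - p z = q z" if "z \<in> ?G" for z
    proof -
      have "p z = z - q z" using on_G[OF that] by (simp add: algebra_simps)
      moreover have "z - q z \<in> primitives"
        using that q_prim by (intro subspace_diff[OF subspace_prim]) auto
      ultimately show "p z \<in> primitives" by (simp only:)
      show "z - p z = q z" using on_G[OF that] by (simp add: algebra_simps)
    qed
    have "rform (flip P) y (p x) = 0"
      using y by (intro rform_prim[OF partial_pairing_flip[OF P] _ _ p_S]) auto
    moreover have "rform P (x - p x) (p y) = 0"
      unfolding p(2)[OF x] using q_G[of x] by (intro rform_prim[OF P _ _ p_S]) auto
    moreover have "\<beta> x y = \<beta> (p x + q x) (p y + q y)"
      unfolding on_G[OF x] on_G[OF y] ..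
    moreover have "\<dots> = \<beta> (q x) (q y)"
      using beta(1,2) p(1)[OF x] p(1)[OF y] q_prim subspace_add[OF subspace_prim]
        beta_decomposable[OF p(1)[OF x] p_S] beta_decomposable[OF p(1)[OF y] p_S]
      by simp
    ultimately show ?thesis by (simp add: Q_def)
  qed
  moreover have "flip Q = Q"
    if "flip P = P" "\<forall>x\<in>primitives. \<forall>y\<in>primitives. \<beta> x y = \<beta> y x"
  proof (intro ext)
    fix x y
    have "\<beta> (q y) (q x) = \<beta> (q x) (q y)" using that(2) q_prim by blast
    \<comment> \<open>Outside the \<open>\<beta>\<close> term, exchanging the arguments of
      \<open>Q\<close> changes only the order in the value on the two components in S.\<close>
    moreover have "rform P (p y) (p x) = rform P (p x) (p y)"
      using rform_flip[OF P p_S p_S, of x y] that(1) by simp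
    ultimately show "flip Q x y = Q x y"
      unfolding flip_def[of Q] Q_def that(1) by (simp add: bilinD[OF R])
  qed
  ultimately show ?thesis using that by blast
qed

lemma good_pairing_step:
  assumes good: "good_pairing n P" and n: "1 \<le> n"
  obtains P' where "good_pairing (Suc n) P'" "\<And>k x y. k \<noteq> n \<Longrightarrow> x \<in> gr k \<Longrightarrow> P' x y = P x y"
    "flip P = P \<Longrightarrow> (\<forall>x\<in>primitives. \<forall>y\<in>primitives. \<beta> x y = \<beta> y x) \<Longrightarrow> flip P' = P'"
proof -
  have P: "partial_pairing n P"
    and nd: "\<forall>k<n. right_nondegenerate k P" "\<forall>k<n. right_nondegenerate k (flip P)"
    and ind: "\<And>k x y. k < n \<Longrightarrow> x \<in> primitives \<inter> gr k \<Longrightarrow> y \<in> primitives \<inter> gr k \<Longrightarrow> P x y = \<beta> x y"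
    using good unfolding good_pairing_def by simp_all
  note bP = partial_pairingD(1)[OF P] and hP = partial_pairingD(2)[OF P]
  obtain Q where bQ: "bilin Q"
    and Q: "\<And>x s. x \<in> gr n \<Longrightarrow> s \<in> decomposables n \<Longrightarrow> Q x s = rform P x s"
    "\<And>y s. y \<in> gr n \<Longrightarrow> s \<in> decomposables n \<Longrightarrow> Q s y = rform (flip P) y s"
    "\<And>x y. x \<in> primitives \<inter> gr n \<Longrightarrow> y \<in> primitives \<inter> gr n \<Longrightarrow> Q x y = \<beta> x y"
    and symQ: "flip P = P \<Longrightarrow> (\<forall>x\<in>primitives. \<forall>y\<in>primitives. \<beta> x y = \<beta> y x) \<Longrightarrow> flip Q = Q"
    using top_form_exists[OF P] by blast
  obtain p where p: "linear_map p" "\<And>x. x \<in> gr n \<Longrightarrow> p x = x"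
    "\<And>k x. k \<noteq> n \<Longrightarrow> x \<in> gr k \<Longrightarrow> p x = 0" "\<And>x. p x \<in> gr n"
    by (rule gr_projection[of n]) (rule that)
  \<comment> \<open>Since \<open>p\<close> projects onto degree \<open>n\<close>, exactly the block
    of degree \<open>n\<close> is replaced by \<open>Q\<close>.\<close>
  define P' where "P' x y = P x y - P (p x) (p y) + Q (p x) (p y)" for x y
  have bP': "bilin P'"
    unfolding bilinear_form_def P'_def
    by (simp add: linear_mapD[OF p(1)] bilinD[OF bP] bilinD[OF bQ] distrib_left right_diff_distrib)
  have agree: "P' x y = P x y" if "k \<noteq> n" "x \<in> gr k" for k x y
    using p(3)[OF that] by (simp add: P'_def bilinD[OF bP] bilinD[OF bQ])
  have top: "P' x y = Q x y" if "x \<in> gr n" "y \<in> gr n" for x y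
    using that by (simp add: P'_def p(2))
  have hP': "homogeneous_form P'"
    unfolding homogeneous_form_def
  proof (intro allI impI)
    fix i j x y assume ij: "i \<noteq> j" "x \<in> gr i" "y \<in> gr j"
    then have "p x = 0 \<or> p y = 0" using p(3)[OF _ ij(2)] p(3)[OF _ ij(3)] by (cases "i = n") auto
    then show "P' x y = 0"
      using homogeneous_formD[OF hP ij] by (auto simp: P'_def bilinD[OF bP] bilinD[OF bQ])
  qed
  have agree': "P' x y = P x y" if "k \<noteq> n" "y \<in> gr k" for k x y
    by (rule homogeneous_agree_right[OF bP bP' hP hP' agree that])
  \<comment> \<open>\<open>one\<close> has degree 0, so \<open>1 \<le> n\<close> keeps it out of the
    altered block.\<close>
  have unit: "P' one x = cou x" "P' x one = cou x" for x
    using agree[OF _ one_gr, of x] agree'[OF _ one_gr, of x] n partial_pairingD(3,4)[OF P] by auto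
  have "right_multiplicative (Suc n) P'"
  proof (rule right_multiplicative_extend[OF P bP' hP' unit(2) agree])
    fix i j x y z assume xyz: "x \<in> gr n" "1 \<le> i" "1 \<le> j" "i + j = n" "y \<in> gr i" "z \<in> gr j"
    have s: "mult y z \<in> decomposables n" using decomposables_mult[OF xyz(2,3,5,6)] xyz(4) by simp
    show "P' x (mult y z) = cosum (\<lambda>a b. P a y * P b z) x"
      unfolding top[OF xyz(1) subsetD[OF decomposables_subset s]] Q(1)[OF xyz(1) s]
      by (rule rform_mult[OF P xyz(1,2,3,5,6)])
  qed
  moreover have "right_multiplicative (Suc n) (flip P')"
  proof (rule right_multiplicative_extend[OF partial_pairing_flip[OF P]])
    show "bilin (flip P')" using bP' by simp
    show "homogeneous_form (flip P')" by (rule homogeneous_form_flip[OF hP'])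
    show "flip P' x one = cou x" for x by (simp add: flip_def unit)
    show "flip P' x y = flip P x y" if "k \<noteq> n" "x \<in> gr k" for k x y
      using agree'[OF that] by (simp add: flip_def)
    fix i j x y z assume xyz: "x \<in> gr n" "1 \<le> i" "1 \<le> j" "i + j = n" "y \<in> gr i" "z \<in> gr j"
    have s: "mult y z \<in> decomposables n" using decomposables_mult[OF xyz(2,3,5,6)] xyz(4) by simp
    have "flip P' x (mult y z) = Q (mult y z) x"
      unfolding flip_def by (rule top[OF subsetD[OF decomposables_subset s] xyz(1)])
    also have "\<dots> = rform (flip P) x (mult y z)" by (rule Q(2)[OF xyz(1) s])
    also have "\<dots> = cosum (\<lambda>a b. flip P a y * flip P b z) x"
      by (rule rform_mult[OF partial_pairing_flip[OF P] xyz(1,2,3,5,6)])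
    finally show "flip P' x (mult y z) = cosum (\<lambda>a b. flip P a y * flip P b z) x" .
  qed
  ultimately have "partial_pairing (Suc n) P'"
    unfolding partial_pairing_def using bP' hP' unit by simp
  moreover have "right_nondegenerate k P' \<and> right_nondegenerate k (flip P')" if k: "k < Suc n" for k
  proof (cases "k = n")
    case False
    then have "P' x y = P x y" "flip P' x y = flip P x y" if "y \<in> gr k" for x y
      using agree'[OF False that] agree[OF False that] by (simp_all add: flip_def)
    moreover have "right_nondegenerate k P" "right_nondegenerate k (flip P)"
      using nd k False by auto
    ultimately show ?thesis unfolding right_nondegenerate_def by simp
  next
    case True
    have "right_nondegenerate n P'"
      unfolding right_nondegenerate_def
    proof (intro ballI impI)
      fix y assume y: "y \<in> gr n" and ker: "\<forall>x\<in>gr n. P' x y = 0"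
      show "y = 0"
      \<comment> \<open>The right kernel of \<open>Q\<close> is the left kernel of
        \<open>flip Q\<close>, which meets the same prescriptions for \<open>flip P\<close> and
        \<open>flip \<beta>\<close>.\<close>
      proof (rule free_cofree_hopf_algebra_form.top_left_kernel[OF flipped partial_pairing_flip[OF P], of "flip Q"])
        show "flip Q y x = 0" if "x \<in> gr n" for x
          using ker top[OF that y] that by (simp add: flip_def)
        show "flip Q x s = rform (flip P) x s" if "x \<in> gr n" "s \<in> decomposables n" for x s
          unfolding flip_def[of Q] by (rule Q(2)[OF that])
        show "flip Q s x = rform (flip (flip P)) x s" if "x \<in> gr n" "s \<in> decomposables n" for x s
          unfolding flip_def[of Q] flip_flip by (rule Q(1)[OF that])
        show "flip Q x y = flip \<beta> x y" if "x \<in> primitives \<inter> gr n" "y \<in> primitives \<inter> gr n" for x y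
          unfolding flip_def by (rule Q(3)[OF that(2,1)])
      qed (use n in \<open>simp_all add: nd y\<close>)
    qed
    moreover have "right_nondegenerate n (flip P')"
      unfolding right_nondegenerate_def
    proof (intro ballI impI)
      fix x assume x: "x \<in> gr n" and ker: "\<forall>y\<in>gr n. flip P' y x = 0"
      show "x = 0"
      proof (rule top_left_kernel[OF P nd n, of Q])
        show "Q x y = 0" if "y \<in> gr n" for y
          using ker top[OF x that] that by (simp add: flip_def)
      qed (rule Q x; assumption)+
    qed
    ultimately show ?thesis using True by simp
  qed
  moreover have "P' x y = \<beta> x y" if "k < Suc n" "x \<in> primitives \<inter> gr k" "y \<in> primitives \<inter> gr k" for k x y
  proof (cases "k = n")
    case True
    then show ?thesis using that top Q(3) by simp
  next
    case False
    then show ?thesis using that agree[OF False] ind[of k x y] by simp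
  qed
  ultimately have "good_pairing (Suc n) P'" unfolding good_pairing_def by simp
  moreover have "flip P' = P'"
    if "flip P = P" "\<forall>x\<in>primitives. \<forall>y\<in>primitives. \<beta> x y = \<beta> y x"
  proof (intro ext)
    fix x y
    have sym: "P a b = P b a" "Q a b = Q b a" for a b
      using fun_cong[OF fun_cong[OF that(1)], of b a] fun_cong[OF fun_cong[OF symQ[OF that]], of b a]
      unfolding flip_def .
    show "flip P' x y = P' x y"
      unfolding flip_def P'_def sym(1)[of y x] sym(1)[of "p y" "p x"] sym(2)[of "p y" "p x"] ..
  qed
  ultimately show ?thesis using that[of P'] agree by simp
qed

text \<open>In degree 0 there are only multiples of \<open>one\<close>, so the unit conditions
  determine the form; it is extended by 0 to positive degrees. A primitive element of degree 0 has
  counit 0 and is 0, so \<open>\<beta>\<close> imposes nothing there.\<close>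

lemma good_pairing_base: "good_pairing 1 (\<lambda>x y. cou x * cou y)"
proof -
  let ?P = "\<lambda>x y. cou x * cou y"
  have flip: "flip ?P = ?P" by (simp add: flip_def fun_eq_iff mult.commute)
  have bil: "bilin ?P" by (rule bilin_tensor[OF linear_form_cou linear_form_cou])
  have "homogeneous_form ?P"
    unfolding homogeneous_form_def
  proof (intro allI impI)
    fix i j x y assume ij: "i \<noteq> j" "x \<in> gr i" "y \<in> gr j"
    then have "1 \<le> i \<or> 1 \<le> j" by linarith
    then show "cou x * cou y = 0" using cou_homog ij by auto
  qed
  moreover have "right_multiplicative 1 ?P"
    unfolding right_multiplicative_def
  proof (intro allI impI ballI)
    fix x y z
    have "cosum (\<lambda>a b. cou a * cou y * (cou b * cou z)) x = cosum (\<lambda>a b. cou a * cou b * (cou y * cou z)) x"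
      by (rule cosum_cong) (simp only: mult_ac)
    also have "\<dots> = cou x * (cou y * cou z)"
      by (simp only: cosum_scale_right cosum_counit_left[OF linear_form_cou])
    finally show "cou x * cou (mult y z) = cosum (\<lambda>a b. cou a * cou y * (cou b * cou z)) x"
      by (simp add: cou_mult)
  qed
  moreover have nd: "right_nondegenerate 0 ?P"
    unfolding right_nondegenerate_def
  proof (intro ballI impI)
    fix y assume y: "y \<in> gr 0" "\<forall>x\<in>gr 0. cou x * cou y = 0"
    then obtain c where c: "y = sc c one" unfolding gr0 by blast
    have "cou y = 0" using y(2) one_gr cou_one by fastforce
    then show "y = 0" unfolding c cou_sc cou_one by simp
  qed
  moreover have "cou x * cou y = \<beta> x y" if x: "x \<in> primitives \<inter> gr 0" and y: "y \<in> primitives \<inter> gr 0" for x y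
  proof -
    obtain c where c: "x = sc c one" using x unfolding gr0 by blast
    have "cou x = 0" using x by (intro cou_prim) blast
    then have "x = 0" unfolding c cou_sc cou_one by simp
    then show ?thesis using beta_0(1) y \<open>cou x = 0\<close> by simp
  qed
  ultimately show ?thesis
    unfolding good_pairing_def partial_pairing_def flip using bil cou_one by simp
qed

end

section \<open>The limit pairing\<close>

context free_cofree_hopf_algebra_form
begin

text \<open>The index is shifted: \<open>F m\<close> is settled up to and including degree
  \<open>m\<close>. Symmetry is carried along as an implication, so that one sequence serves both
  claims.\<close>

lemma good_pairing_sequence:
  obtains F where "\<And>m. good_pairing (Suc m) (F m)"
    "\<And>m k x y. k \<noteq> Suc m \<Longrightarrow> x \<in> gr k \<Longrightarrow> F (Suc m) x y = F m x y"
    "\<And>m. (\<forall>x\<in>primitives. \<forall>y\<in>primitives. \<beta> x y = \<beta> y x) \<Longrightarrow> flip (F m) = F m"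
proof -
  let ?sym = "\<forall>x\<in>primitives. \<forall>y\<in>primitives. \<beta> x y = \<beta> y x"
  have "\<exists>F. \<forall>m. (good_pairing (Suc m) (F m) \<and> (?sym \<longrightarrow> flip (F m) = F m))
      \<and> (\<forall>k x y. k \<noteq> Suc m \<longrightarrow> x \<in> gr k \<longrightarrow> F (Suc m) x y = F m x y)"
  proof (rule dependent_nat_choice)
    show "\<exists>P. good_pairing (Suc 0) P \<and> (?sym \<longrightarrow> flip P = P)"
      by (intro exI[of _ "\<lambda>x y. cou x * cou y"])
        (use good_pairing_base in \<open>simp add: flip_def fun_eq_iff mult.commute\<close>)
    fix P m assume P: "good_pairing (Suc m) P \<and> (?sym \<longrightarrow> flip P = P)"
    then have "good_pairing (Suc m) P" by simp
    then obtain P' where "good_pairing (Suc (Suc m)) P'"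
      "\<And>k x y. k \<noteq> Suc m \<Longrightarrow> x \<in> gr k \<Longrightarrow> P' x y = P x y"
      "flip P = P \<Longrightarrow> ?sym \<Longrightarrow> flip P' = P'"
      by (rule good_pairing_step[of "Suc m"]) (simp, rule that)
    with P show "\<exists>P'. (good_pairing (Suc (Suc m)) P' \<and> (?sym \<longrightarrow> flip P' = P'))
        \<and> (\<forall>k x y. k \<noteq> Suc m \<longrightarrow> x \<in> gr k \<longrightarrow> P' x y = P x y)"
      by (intro exI[of _ P']) simp
  qed
  then obtain F where F: "\<forall>m. (good_pairing (Suc m) (F m) \<and> (?sym \<longrightarrow> flip (F m) = F m))
      \<and> (\<forall>k x y. k \<noteq> Suc m \<longrightarrow> x \<in> gr k \<longrightarrow> F (Suc m) x y = F m x y)" ..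
  show ?thesis by (rule that[of F]) (use F in simp_all)
qed

text \<open>Every \<open>x\<close> has finitely many homogeneous components, so
  \<open>F m x y\<close> is eventually constant in \<open>m\<close>. Each required identity involves
  finitely many left arguments and can be checked at a single late stage.\<close>

lemma hopf_pairing_exists:
  obtains P where "hopf_pairing sc gr mult one cop cou P" "nondegenerate P"
    "\<forall>x\<in>primitives. \<forall>y\<in>primitives. P x y = \<beta> x y"
    "(\<forall>x\<in>primitives. \<forall>y\<in>primitives. \<beta> x y = \<beta> y x) \<Longrightarrow> (\<forall>x y. P x y = P y x)"
proof -
  obtain F where good: "\<And>m. good_pairing (Suc m) (F m)"
    and agree: "\<And>m k x y. k \<noteq> Suc m \<Longrightarrow> x \<in> gr k \<Longrightarrow> F (Suc m) x y = F m x y"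
    and sym: "\<And>m. (\<forall>x\<in>primitives. \<forall>y\<in>primitives. \<beta> x y = \<beta> y x) \<Longrightarrow> flip (F m) = F m"
    by (rule good_pairing_sequence) (rule that)
  have pp: "partial_pairing (Suc m) (F m)" for m
    using good[of m] unfolding good_pairing_def by simp
  note bF = partial_pairingD(1)[OF pp]
  have stable: "F m x y = F k x y" if "x \<in> gr k" "k \<le> m" for k m x y
    using that(2)
  proof (induction m rule: dec_induct)
    case (step m)
    then show ?case using agree[of k m x y] \<open>x \<in> gr k\<close> by simp
  qed simp
  \<comment> \<open>The bound is the largest degree occurring in \<open>x\<close>; as it does not
    depend on \<open>y\<close>, only left arguments have to be controlled from here on.\<close>
  have "\<exists>N. \<forall>m\<ge>N. \<forall>y. F m x y = F N x y" for x
  proof -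
    obtain I f where f: "finite I" "\<And>k. k \<in> I \<Longrightarrow> f k \<in> gr k" "x = (\<Sum>k\<in>I. f k)"
      by (rule homogeneous_decomposition) (rule that)
    have "F m x y = (\<Sum>k\<in>I. F k (f k) y)" if "Max (insert 0 I) \<le> m" for m y
      unfolding f(3) linear_formD(5)[OF bilin_linear(1)[OF bF]]
      by (rule sum.cong) (use f(1) that in \<open>auto intro!: stable[OF f(2)] elim: order_trans[rotated]\<close>)
    then show ?thesis by (intro exI[of _ "Max (insert 0 I)"]) simp
  qed
  then obtain N where N: "\<And>x m y. N x \<le> m \<Longrightarrow> F m x y = F (N x) x y" by metis
  define P where "P x y = F (N x) x y" for x y
  have limit: "\<exists>m\<ge>M. \<forall>x\<in>X. \<forall>y. P x y = F m x y" if "finite X" for M X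
  proof (intro exI conjI ballI allI)
    show "M \<le> Max (insert M (N ` X))" using that by simp
    show "P x y = F (Max (insert M (N ` X))) x y" if "x \<in> X" for x y
      unfolding P_def using that \<open>finite X\<close> by (intro N[symmetric]) simp
  qed
  have on_gr: "P x y = F m x y" if "x \<in> gr k" "k \<le> m" for k m x y
  proof -
    obtain m' where m': "k \<le> m'" "P x y = F m' x y" using limit[of "{x}" k] by auto
    show ?thesis unfolding m'(2) stable[OF that(1) m'(1)] stable[OF that] ..
  qed
  have bP: "bilin P"
    unfolding bilinear_form_def
  proof (intro conjI allI)
    fix x y z c
    obtain m where m: "\<forall>a\<in>{x, y, z, x + y, sc c x}. \<forall>b. P a b = F m a b"
      using limit[of "{x, y, z, x + y, sc c x}" 0] by auto
    show "P (x + y) z = P x z + P y z" "P z (x + y) = P z x + P z y"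
      "P (sc c x) y = c * P x y" "P x (sc c y) = c * P x y"
      using m by (simp_all add: bilinD[OF bF])
  qed
  have homP: "P x y = 0" if "i \<noteq> j" "x \<in> gr i" "y \<in> gr j" for i j x y
    unfolding on_gr[OF that(2) order_refl] by (rule homogeneous_formD[OF partial_pairingD(2)[OF pp] that])
  have right: "P x (mult y z) = cosum (\<lambda>a b. P a y * P b z) x" for x y z
  proof (rule linear_form_eqI[OF bilin_linear(1)[OF bP] linear_form_cosum[OF bilin_pair[OF bP bP]]])
    fix k x assume x: "x \<in> gr k"
    \<comment> \<open>The list \<open>cop x\<close> is finite, so one stage computes
      \<open>P\<close> on \<open>x\<close> and on all factors in that list.\<close>
    let ?X = "insert x (fst ` set (cop x) \<union> snd ` set (cop x))"
    obtain m where m: "k \<le> m" "\<forall>a\<in>?X. \<forall>b. P a b = F m a b"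
      using limit[of ?X k] by auto
    have "cosum (\<lambda>a b. P a y * P b z) x = cosum (\<lambda>a b. F m a y * F m b z) x"
      unfolding cosum_def
    proof (rule arg_cong[of _ _ sum_list], rule map_cong[OF refl])
      fix q assume "q \<in> set (cop x)"
      then have "fst q \<in> ?X" "snd q \<in> ?X" by auto
      with m(2) have "P (fst q) y = F m (fst q) y" "P (snd q) z = F m (snd q) z" by blast+
      then show "(case q of (a, b) \<Rightarrow> P a y * P b z) = (case q of (a, b) \<Rightarrow> F m a y * F m b z)"
        by (simp add: case_prod_unfold)
    qed
    also have "\<dots> = F m x (mult y z)"
      by (rule right_multiplicativeD[OF partial_pairingD(5)[OF pp] _ x, symmetric]) (use m(1) in simp)
    finally show "P x (mult y z) = cosum (\<lambda>a b. P a y * P b z) x" using m(2) by simp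
  qed
  have left: "P (mult x y) z = cosum (\<lambda>a b. P x a * P y b) z" for x y z
  proof (rule linear_form_eqI[OF bilin_linear(2)[OF bP] linear_form_cosum[OF bilin_tensor[OF bilin_linear(2)[OF bP] bilin_linear(2)[OF bP]]]])
    fix k z assume z: "z \<in> gr k"
    obtain m where m: "k \<le> m" "\<forall>a\<in>{mult x y, x, y}. \<forall>b. P a b = F m a b"
      using limit[of "{mult x y, x, y}" k] by auto
    have "flip (F m) z (mult x y) = cosum (\<lambda>a b. flip (F m) a x * flip (F m) b y) z"
      by (rule right_multiplicativeD[OF partial_pairingD(6)[OF pp] _ z]) (use m(1) in simp)
    then show "P (mult x y) z = cosum (\<lambda>a b. P x a * P y b) z"
      using m(2) by (simp add: flip_def)
  qed
  have unit: "P one x = cou x" "P x one = cou x" for x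
  proof -
    show "P one x = cou x"
      unfolding on_gr[OF one_gr order_refl] by (rule partial_pairingD(3)[OF pp])
    obtain m where "P x one = F m x one" using limit[of "{x}" 0] by auto
    then show "P x one = cou x" using partial_pairingD(4)[OF pp] by simp
  qed
  have "hopf_pairing sc gr mult one cop cou P"
    unfolding hopf_pairing_def using bP unit left right homP by (simp add: cosum_def)
  moreover have "nondegenerate P"
  proof -
    have nd: "right_nondegenerate k (F k)" "right_nondegenerate k (flip (F k))" for k
      using good[of k] unfolding good_pairing_def by simp_all
    have "x = 0" if "\<And>y. P x y = 0" for x
    proof -
      obtain I f where f: "finite I" "\<And>k. k \<in> I \<Longrightarrow> f k \<in> gr k" "x = (\<Sum>k\<in>I. f k)"
        by (rule homogeneous_decomposition) (rule that)
      have "f k = 0" if k: "k \<in> I" for k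
      proof -
        have "F k (f k) y = 0" if y: "y \<in> gr k" for y
        proof -
          have "0 = (\<Sum>j\<in>I. P (f j) y)"
            using \<open>\<And>y. P x y = 0\<close>[of y] unfolding f(3) linear_formD(5)[OF bilin_linear(1)[OF bP]] ..
          also have "\<dots> = P (f k) y"
            using f(1) k homP[OF _ f(2) y] by (subst sum.remove[of _ k]) (auto intro!: sum.neutral)
          also have "\<dots> = F k (f k) y" by (rule on_gr[OF f(2)[OF k] order_refl])
          finally show ?thesis ..
        qed
        then show ?thesis
          using nd(2)[of k] f(2)[OF k] unfolding right_nondegenerate_def flip_def by simp
      qed
      then show "x = 0" unfolding f(3) by simp
    qed
    moreover have "y = 0" if "\<And>x. P x y = 0" for y
    proof -
      obtain I f where f: "finite I" "\<And>k. k \<in> I \<Longrightarrow> f k \<in> gr k" "y = (\<Sum>k\<in>I. f k)"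
        by (rule homogeneous_decomposition) (rule that)
      have "f k = 0" if k: "k \<in> I" for k
      proof -
        have "F k x (f k) = 0" if x: "x \<in> gr k" for x
        proof -
          have "0 = (\<Sum>j\<in>I. P x (f j))"
            using \<open>\<And>x. P x y = 0\<close>[of x] unfolding f(3) linear_formD(5)[OF bilin_linear(2)[OF bP]] ..
          also have "\<dots> = P x (f k)"
            using f(1) k homP[OF _ x f(2)] by (subst sum.remove[of _ k]) (auto intro!: sum.neutral)
          also have "\<dots> = F k x (f k)" by (rule on_gr[OF x order_refl])
          finally show ?thesis ..
        qed
        then show ?thesis
          using nd(1)[of k] f(2)[OF k] unfolding right_nondegenerate_def by simp
      qed
      then show "y = 0" unfolding f(3) by simp
    qed
    ultimately show ?thesis unfolding nondegenerate_def by simp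
  qed
  moreover have "\<forall>x\<in>primitives. \<forall>y\<in>primitives. P x y = \<beta> x y"
  proof -
    have letters: "P (e [c]) (e [d]) = \<beta> (e [c]) (e [d])" if "c \<in> C" "d \<in> C" for c d
    proof (cases "cdeg c = cdeg d")
      case True
      have "P (e [c]) (e [d]) = F (cdeg c) (e [c]) (e [d])"
        by (rule on_gr[OF coletter_prim(2)[OF that(1)] order_refl])
      also have "\<dots> = \<beta> (e [c]) (e [d])"
        by (rule good[unfolded good_pairing_def, THEN conjunct2, THEN conjunct2, rule_format, OF lessI])
          (simp_all add: True coletter_prim that coletter_prim(2)[OF that(1), unfolded True])
      finally show ?thesis .
    next
      case False
      then show ?thesis
        using homP[OF False] beta_homogeneous coletter_prim[OF that(1)] coletter_prim[OF that(2)] by simp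
    qed
    \<comment> \<open>\<open>\<beta>\<close> is bilinear on primitive elements only, so the equality
      is extended from the cogenerators within \<open>primitives\<close>, one argument at a
      time.\<close>
    have "primitives \<subseteq> {y \<in> primitives. P (e [c]) y = \<beta> (e [c]) y}" if c: "c \<in> C" for c
    proof (subst prim_eq_span, rule span_minimal)
      show "coletters \<subseteq> {y \<in> primitives. P (e [c]) y = \<beta> (e [c]) y}"
        using letters[OF c] coletter_prim(1) by auto
      show "subspace {y \<in> primitives. P (e [c]) y = \<beta> (e [c]) y}"
        unfolding subspace_def using subspace_prim[unfolded subspace_def] coletter_prim(1)[OF c]
        by (simp add: beta_0 beta bilinD[OF bP])
    qed
    then have half: "P (e [c]) y = \<beta> (e [c]) y" if "c \<in> C" "y \<in> primitives" for c y using that by auto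
    have "primitives \<subseteq> {x \<in> primitives. P x y = \<beta> x y}" if y: "y \<in> primitives" for y
    proof (subst prim_eq_span, rule span_minimal)
      show "coletters \<subseteq> {x \<in> primitives. P x y = \<beta> x y}"
        using half[OF _ y] coletter_prim(1) by auto
      show "subspace {x \<in> primitives. P x y = \<beta> x y}"
        unfolding subspace_def using subspace_prim[unfolded subspace_def] y
        by (simp add: beta_0 beta bilinD[OF bP])
    qed
    then show ?thesis by auto
  qed
  moreover have "\<forall>x y. P x y = P y x" if "\<forall>x\<in>primitives. \<forall>y\<in>primitives. \<beta> x y = \<beta> y x"
  proof (intro allI)
    fix x y
    obtain m where m: "\<forall>a\<in>{x, y}. \<forall>b. P a b = F m a b" using limit[of "{x, y}" 0] by auto
    have "F m y x = F m x y" using fun_cong[OF fun_cong[OF sym[OF that, of m]], of x y] unfolding flip_def .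
    then show "P x y = P y x" using m by simp
  qed
  ultimately show ?thesis using that by blast
qed

end

theorem theorem5:
  fixes sc :: "'k::field \<Rightarrow> 'h::ab_group_add \<Rightarrow> 'h"
    and gr :: "nat \<Rightarrow> 'h set"
    and mult :: "'h \<Rightarrow> 'h \<Rightarrow> 'h"
    and one :: 'h
    and cop :: "'h \<Rightarrow> ('h \<times> 'h) list"
    and cou :: "'h \<Rightarrow> 'k"
    and ant :: "'h \<Rightarrow> 'h"
    and \<beta> :: "'h \<Rightarrow> 'h \<Rightarrow> 'k"
  assumes char: "(2::'k) \<noteq> 0"
    and H: "graded_connected_hopf_algebra sc gr mult one cop cou ant"
    and free: "free_graded_algebra sc gr mult one"
    and cofree: "cofree_graded_coalgebra sc gr cop cou"
    and form: "quotient_form sc (prim sc one cop) (aug_ideal_sq sc gr mult) \<beta>"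
    and nondeg: "quotient_form_nondegenerate (prim sc one cop) (aug_ideal_sq sc gr mult) \<beta>"
    and homog: "quotient_form_homogeneous gr (prim sc one cop) \<beta>"
  shows "(\<exists>P. hopf_pairing sc gr mult one cop cou P \<and> nondegenerate P
              \<and> (\<forall>x\<in>prim sc one cop. \<forall>y\<in>prim sc one cop. P x y = \<beta> x y))
       \<and> ((\<forall>x\<in>prim sc one cop. \<forall>y\<in>prim sc one cop. \<beta> x y = \<beta> y x) \<longrightarrow>
          (\<exists>P. hopf_pairing sc gr mult one cop cou P \<and> nondegenerate P
              \<and> (\<forall>x\<in>prim sc one cop. \<forall>y\<in>prim sc one cop. P x y = \<beta> x y)
              \<and> (\<forall>x y. P x y = P y x)))"
proof -
  obtain B where B: "B \<subseteq> (\<Union>n. gr n)" "inj_on (word mult one) (lists B)"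
    "\<not> module.dependent sc (word mult one ` lists B)" "module.span sc (word mult one ` lists B) = UNIV"
    using free unfolding free_graded_algebra_def by (elim exE conjE)
  obtain C :: "'h set" and cdeg e where C: "\<forall>c\<in>C. cdeg c \<ge> 1" "inj_on e (lists C)"
    "\<not> module.dependent sc (e ` lists C)" "module.span sc (e ` lists C) = UNIV"
    "\<forall>w\<in>lists C. e w \<in> gr (\<Sum>b\<leftarrow>w. cdeg b)"
    "\<forall>w\<in>lists C. tensor_eq sc (cop (e w)) (map (\<lambda>i. (e (take i w), e (drop i w))) [0..<Suc (length w)])"
    "\<forall>w\<in>lists C. cou (e w) = (if w = [] then 1 else 0)"
    using cofree unfolding cofree_graded_coalgebra_def by (elim exE conjE)
  interpret graded_connected_hopf_algebra sc gr mult one cop cou ant by (rule H)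
  interpret free_cofree_hopf_algebra_form sc gr mult one cop cou ant B C cdeg e \<beta>
    by unfold_locales (fact B C(1-4) C(5-7)[rule_format] form nondeg homog)+
  obtain P where "hopf_pairing sc gr mult one cop cou P" "nondegenerate P"
    "\<forall>x\<in>primitives. \<forall>y\<in>primitives. P x y = \<beta> x y"
    "(\<forall>x\<in>primitives. \<forall>y\<in>primitives. \<beta> x y = \<beta> y x) \<Longrightarrow> (\<forall>x y. P x y = P y x)"
    by (rule hopf_pairing_exists) (rule that)
  then show ?thesis by (intro conjI impI exI[of _ P]) auto
qed

end
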